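(* Let $p,q\ge 2$, let $C_4=[12][13][24][34]$ be the four-cycle and $d=(p,2,3,q)$. Let $\succeq_\times,\succeq_{\mathcal{B}},\succeq_{\mathcal{B}'},\succeq_{\mathcal{A}}$ be preorders satisfying the compatibility requirements listed in the context. Then the following moves form a $\succeq_\times$-Gröbner basis of $\mathcal{F}(\mathcal{B}_{C_4,d})$ (written in tableau notation): $$\begin{bmatrix}a_1 b c e_1\\ a_2 b c e_2\end{bmatrix}-\begin{bmatrix}a_1 b c e_2\\ a_2 b c e_1\end{bmatrix},\quad \begin{bmatrix}a_1 1 c_1 e_1\\ a_2 2 c_1 e_2\\ a_2 1 c_2 e_3\\ a_1 2 c_2 e_4\end{bmatrix}-\begin{bmatrix}a_2 1 c_1 e_1\\ a_1 2 c_1 e_2\\ a_1 1 c_2 e_3\\ a_2 2 c_2 e_4\end{bmatrix},\quad \begin{bmatrix}a_1 1 c_1 e_1\\ a_2 2 c_1 e_2\\ a_3 1 c_2 e_2\\ a_4 2 c_2 e_1\end{bmatrix}-\begin{bmatrix}a_1 1 c_1 e_2\\ a_2 2 c_1 e_1\\ a_3 1 c_2 e_1\\ a_4 2 c_2 e_2\end{bmatrix},$$ $$\begin{bmatrix}a_1 1 1 e_1\\ a_2 1 2 e_2\\ a_3 1 3 e_3\\ a_2 2 1 e_4\\ a_3 2 2 e_5\\ a_1 2 3 e_6\end{bmatrix}-\begin{bmatrix}a_2 1 1 e_1\\ a_3 1 2 e_2\\ a_1 1 3 e_3\\ a_1 2 1 e_4\\ a_2 2 2 e_5\\ a_3 2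 3 e_6\end{bmatrix},\quad \begin{bmatrix}a_1 1 1 e_1\\ a_2 1 2 e_2\\ a_3 1 3 e_3\\ a_4 2 1 e_2\\ a_5 2 2 e_3\\ a_6 2 3 e_1\end{bmatrix}-\begin{bmatrix}a_1 1 1 e_2\\ a_2 1 2 e_3\\ a_3 1 3 e_1\\ a_4 2 1 e_1\\ a_5 2 2 e_2\\ a_6 2 3 e_3\end{bmatrix},$$ together with $$\begin{bmatrix}a 1 c_1 e\\ a 2 c_2 e\end{bmatrix}-\begin{bmatrix}a 1 c_2 e\\ a 2 c_1 e\end{bmatrix},\quad \begin{bmatrix}a_1 1 c_1 e_1\\ a_1 2 c_2 e_2\\ a_2 1 c_2 e_3\\ a_2 2 c_3 e_1\end{bmatrix}-\begin{bmatrix}a_1 1 c_2 e_3\\ a_1 2 c_1 e_1\\ a_2 1 c_3 e_1\\ a_2 2 c_2 e_2\end{bmatrix},\quad \begin{bmatrix}a_1 1 c_1 e_1\\ a_2 2 c_2 e_1\\ a_3 1 c_2 e_2\\ a_1 2 c_3 e_2\end{bmatrix}-\begin{bmatrix}a_3 1 c_2 e_1\\ a_1 2 c_1 e_1\\ a_1 1 c_3 e_2\\ a_2 2 c_2 e_2\end{bmatrix},$$ where $a,a_1,\dots,a_6$ range over $[p]$, $b$ over $[2]$, $c,c_1,c_2,c_3$ over $\{1,2,3\}$, and $e,e_1,\dots,e_6$ over $[q]$.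
   Context: $\mathbb{N}=\{0,1,\dots\}$, $[k]=\{1,\dots,k\}$. Let $X=[p]\times[2]\times[3]\times[q]$. $\mathcal{B}_{C_4,d}$ is the matrix of the linear map on $\mathbb{Z}^X$ that sends a 4-way table to the collection of its two-way marginals for the pairs of positions $\{1,2\},\{1,3\},\{2,4\},\{3,4\}$. Tableau notation: a tableau with rows $i^{(1)},\dots,i^{(k)}\in X$ denotes $\sum_j \mathbf{e}_{i^{(j)}}\in\mathbb{Z}^X$, where $\mathbf{e}_i$ is the standard unit vector; a row such as $a\,b\,c\,e$ denotes the index $(a,b,c,e)$. For an integer matrix $\mathcal{B}$ with $n$ columns, $\mathcal{F}(\mathcal{B})$ is the collection of all fibers $F(\mathcal{B},\beta)=\{v\in\mathbb{N}^n:\mathcal{B}v=\beta\}$, with $\beta$ an integer vector. An additive preorder on $\mathbb{Z}^n$ is a reflexive, transitive relation $\succeq$ such that any two elements are comparable and $u\succeq v$ implies $u+w\succeq v+w$. For $F,\mathcal{M}\subseteq\mathbb{Z}^n$, $F_{\mathcal{M},\succeq}$ is the directed graph on $F$ with an edge $u\to v$ iff $v-u\in\pm\mathcal{M}$ and $u\succeq v$; $u\sim v$ if each is reachable from the other by a directed path. $\mathcal{M}$ is a $\succeq$-Gröbner basis of a collection $\mathcal{F}$ if for all $F\in\mathcal{F}$: (1) $F_{\mathcal{M},\succeq}$ is weakly connected; (2) the quotient $F_{\mathcal{M},\succeq}/{\sim}$ has at most one sink; (3) each sink of the quotient is a $\succeq$-minimum of $F$. Compatibility requirements. Let $\psi:\mathbb{Z}^X\to\mathbb{Z}^{[p]\times[2]\times[3]}$,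 $\psi':\mathbb{Z}^X\to\mathbb{Z}^{[2]\times[3]\times[q]}$, $\phi:\mathbb{Z}^{[p]\times[2]\times[3]}\to\mathbb{Z}^{[2]\times[3]}$, $\phi':\mathbb{Z}^{[2]\times[3]\times[q]}\to\mathbb{Z}^{[2]\times[3]}$ be the marginalization maps (given on unit vectors by $\psi(\mathbf{e}_{abce})=\mathbf{e}_{abc}$, $\psi'(\mathbf{e}_{abce})=\mathbf{e}_{bce}$, $\phi(\mathbf{e}_{abc})=\mathbf{e}_{bc}$, $\phi'(\mathbf{e}_{bce})=\mathbf{e}_{bc}$), and $\xi=\phi\psi=\phi'\psi'$. Let $\mathcal{B}$ be the matrix of the map taking a table in $\mathbb{Z}^{[p]\times[2]\times[3]}$ (positions 1,2,3) to its $\{1,2\}$- and $\{1,3\}$-marginals, and $\mathcal{B}'$ the matrix of the map taking a table in $\mathbb{Z}^{[2]\times[3]\times[q]}$ (positions 2,3,4) to its $\{2,4\}$- and $\{3,4\}$-marginals. $\succeq_\times,\succeq_{\mathcal{B}},\succeq_{\mathcal{B}'},\succeq_{\mathcal{A}}$ are additive preorders on $\mathbb{Z}^X$, $\mathbb{Z}^{[p]\times[2]\times[3]}$, $\mathbb{Z}^{[2]\times[3]\times[q]}$, $\mathbb{Z}^{[2]\times[3]}$ such that: (i) whenever $u,v$ lie in a common fiber of $\mathcal{B}$ and $\phi(u)\neq\phi(v)$, then $u\succeq_{\mathcal{B}}v\iff\phi(u)\succeq_{\mathcal{A}}\phi(v)$; likewise for $(\mathcal{B}',\phi',\succeq_{\mathcal{B}'})$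 and for $(\mathcal{B}_{C_4,d},\xi,\succeq_\times)$; (ii) for all $u_1,u_2\in\mathbb{Z}^X$, if $\psi(u_1)\succeq_{\mathcal{B}}\psi(u_2)$ and $\psi'(u_1)\succeq_{\mathcal{B}'}\psi'(u_2)$, then $u_1\succeq_\times u_2$. *)

theory Defs
  imports "HOL-Analysis.Analysis"
begin

section \<open>Fibers and preorders\<close>

text \<open>The elements of \<open>\<nat>\<^sup>n\<close> are the integer vectors with nonnegative entries.\<close>

definition fiber :: "int ^ 'n ^ 'm \<Rightarrow> int ^ 'm \<Rightarrow> (int ^ 'n) set" where
  "fiber B \<beta> = {v. (\<forall>i. 0 \<le> v $ i) \<and> B *v v = \<beta>}"

definition fibers :: "int ^ 'n ^ 'm \<Rightarrow> (int ^ 'n) set set" where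
  "fibers B = range (fiber B)"

text \<open>Throughout, \<open>R u v\<close> stands for \<open>u \<succeq> v\<close>.\<close>

definition additive_preorder :: "('v::ab_group_add \<Rightarrow> 'v \<Rightarrow> bool) \<Rightarrow> bool" where
  "additive_preorder R \<longleftrightarrow>
     reflp R \<and> transp R \<and>
     (\<forall>u v. R u v \<or> R v u) \<and>
     (\<forall>u v w. R u v \<longrightarrow> R (u + w) (v + w))"


section \<open>Groebner bases with respect to a preorder\<close>

definition move_graph ::
  "('v::ab_group_add \<Rightarrow> 'v \<Rightarrow> bool) \<Rightarrow> 'v set \<Rightarrow> 'v set \<Rightarrow> ('v \<times> 'v) set" where
  "move_graph R M F =
     {(u, v). u \<in> F \<and> v \<in> F \<and> v - u \<in> M \<union> uminus ` M \<and> R u v}"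

text \<open>The empty graph counts as connected; this matters because fibers may be empty.\<close>

definition weakly_connected :: "'v set \<Rightarrow> ('v \<times> 'v) set \<Rightarrow> bool" where
  "weakly_connected V E \<longleftrightarrow> (\<forall>u\<in>V. \<forall>v\<in>V. (u, v) \<in> (E \<union> E\<inverse>)\<^sup>*)"

definition mutually_reachable :: "'v set \<Rightarrow> ('v \<times> 'v) set \<Rightarrow> ('v \<times> 'v) set" where
  "mutually_reachable V E = {(u, v). u \<in> V \<and> v \<in> V \<and> (u, v) \<in> E\<^sup>* \<and> (v, u) \<in> E\<^sup>*}"

definition quotient_edges :: "'v set \<Rightarrow> ('v \<times> 'v) set \<Rightarrow> ('v set \<times> 'v set) set" where
  "quotient_edges V E =
     {(C, D). C \<in> V // mutually_reachable V E \<and> D \<in> V // mutually_reachable V E \<and>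
              C \<noteq> D \<and> (\<exists>u\<in>C. \<exists>v\<in>D. (u, v) \<in> E)}"

definition quotient_sinks :: "'v set \<Rightarrow> ('v \<times> 'v) set \<Rightarrow> 'v set set" where
  "quotient_sinks V E =
     {C \<in> V // mutually_reachable V E. \<not> (\<exists>D. (C, D) \<in> quotient_edges V E)}"

definition is_minimum :: "('v \<Rightarrow> 'v \<Rightarrow> bool) \<Rightarrow> 'v set \<Rightarrow> 'v \<Rightarrow> bool" where
  "is_minimum R F u \<longleftrightarrow> u \<in> F \<and> (\<forall>v\<in>F. R v u)"

text \<open>
  A sink of the quotient is a class of vertices; it is a minimum of \<open>F\<close> when its members are.
\<close>

definition groebner_basis ::
  "('v::ab_group_add \<Rightarrow> 'v \<Rightarrow> bool) \<Rightarrow> 'v set \<Rightarrow> 'v set set \<Rightarrow> bool" where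
  "groebner_basis R M \<F> \<longleftrightarrow>
     (\<forall>F\<in>\<F>.
        weakly_connected F (move_graph R M F) \<and>
        (\<forall>C \<in> quotient_sinks F (move_graph R M F).
           \<forall>D \<in> quotient_sinks F (move_graph R M F). C = D) \<and>
        (\<forall>C \<in> quotient_sinks F (move_graph R M F). \<forall>u\<in>C. is_minimum R F u))"


section \<open>Marginals of tables\<close>

text \<open>
  The index sets \<open>[p]\<close> and \<open>[q]\<close> are finite types \<open>'p\<close>, \<open>'q\<close>; \<open>[2]\<close> and \<open>[3]\<close> are the
  numeral types. In the latter the numeral equal to the cardinality coincides with \<open>0\<close>, so
  that the elements are \<open>1, 2\<close> and \<open>1, 2, 3\<close>, respectively.
\<close>

definition marginal :: "('i::finite \<Rightarrow> 'j::finite) \<Rightarrow> int ^ 'i \<Rightarrow> int ^ 'j" where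
  "marginal \<pi> u = (\<chi> j. \<Sum>i | \<pi> i = j. u $ i)"

lemma marginal_axis: "marginal \<pi> (axis i 1) = axis (\<pi> i) 1"
  by (auto simp: marginal_def axis_def vec_eq_iff if_distrib sum.If_cases Int_def cong: if_cong)

definition psi :: "int ^ ('p::finite \<times> 2 \<times> 3 \<times> 'q::finite) \<Rightarrow> int ^ ('p \<times> 2 \<times> 3)" where
  "psi = marginal (\<lambda>(a, b, c, e). (a, b, c))"

definition psi' :: "int ^ ('p::finite \<times> 2 \<times> 3 \<times> 'q::finite) \<Rightarrow> int ^ (2 \<times> 3 \<times> 'q)" where
  "psi' = marginal (\<lambda>(a, b, c, e). (b, c, e))"

definition phi :: "int ^ ('p::finite \<times> 2 \<times> 3) \<Rightarrow> int ^ (2 \<times> 3)" where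
  "phi = marginal (\<lambda>(a, b, c). (b, c))"

definition phi' :: "int ^ (2 \<times> 3 \<times> 'q::finite) \<Rightarrow> int ^ (2 \<times> 3)" where
  "phi' = marginal (\<lambda>(b, c, e). (b, c))"

definition xi :: "int ^ ('p::finite \<times> 2 \<times> 3 \<times> 'q::finite) \<Rightarrow> int ^ (2 \<times> 3)" where
  "xi = phi \<circ> psi"

lemma marginal_marginal: "marginal \<rho> (marginal \<pi> u) = marginal (\<rho> \<circ> \<pi>) u"
proof -
  have "(\<Sum>j | \<rho> j = k. \<Sum>i | \<pi> i = j. u $ i) = (\<Sum>i | \<rho> (\<pi> i) = k. u $ i)" for k
    by (subst sum.group[of "{i. \<rho> (\<pi> i) = k}" "{j. \<rho> j = k}" \<pi> "($) u", symmetric])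
       (auto intro!: sum.cong)
  then show ?thesis
    by (simp add: marginal_def vec_eq_iff)
qed

lemma xi_eq: "xi = phi' \<circ> psi'"
  by (simp add: xi_def phi_def psi_def phi'_def psi'_def fun_eq_iff marginal_marginal
        comp_def case_prod_unfold)

text \<open>A collection of marginals is a vector over the disjoint union of their index sets.\<close>

definition marginals_C4 ::
  "int ^ ('p::finite \<times> 2 \<times> 3 \<times> 'q::finite) \<Rightarrow>
   int ^ (('p \<times> 2) + ('p \<times> 3) + (2 \<times> 'q) + (3 \<times> 'q))" where
  "marginals_C4 u = (\<chi> r. case r of
       Inl ab \<Rightarrow> marginal (\<lambda>(a, b, c, e). (a, b)) u $ ab
     | Inr (Inl ac) \<Rightarrow> marginal (\<lambda>(a, b, c, e). (a, c)) u $ ac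
     | Inr (Inr (Inl be)) \<Rightarrow> marginal (\<lambda>(a, b, c, e). (b, e)) u $ be
     | Inr (Inr (Inr ce)) \<Rightarrow> marginal (\<lambda>(a, b, c, e). (c, e)) u $ ce)"

definition marginals_left ::
  "int ^ ('p::finite \<times> 2 \<times> 3) \<Rightarrow> int ^ (('p \<times> 2) + ('p \<times> 3))" where
  "marginals_left u = (\<chi> r. case r of
       Inl ab \<Rightarrow> marginal (\<lambda>(a, b, c). (a, b)) u $ ab
     | Inr ac \<Rightarrow> marginal (\<lambda>(a, b, c). (a, c)) u $ ac)"

definition marginals_right ::
  "int ^ (2 \<times> 3 \<times> 'q::finite) \<Rightarrow> int ^ ((2 \<times> 'q) + (3 \<times> 'q))" where
  "marginals_right u = (\<chi> r. case r of
       Inl be \<Rightarrow> marginal (\<lambda>(b, c, e). (b, e)) u $ be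
     | Inr ce \<Rightarrow> marginal (\<lambda>(b, c, e). (c, e)) u $ ce)"

definition B_C4 ::
  "int ^ ('p::finite \<times> 2 \<times> 3 \<times> 'q::finite)
       ^ (('p \<times> 2) + ('p \<times> 3) + (2 \<times> 'q) + (3 \<times> 'q))" where
  "B_C4 = matrix marginals_C4"

definition B_left :: "int ^ ('p::finite \<times> 2 \<times> 3) ^ (('p \<times> 2) + ('p \<times> 3))" where
  "B_left = matrix marginals_left"

definition B_right :: "int ^ (2 \<times> 3 \<times> 'q::finite) ^ ((2 \<times> 'q) + (3 \<times> 'q))" where
  "B_right = matrix marginals_right"

lemma sum_marginal_axis: "(\<Sum>i\<in>UNIV. marginal \<pi> (axis i 1) $ j * u $ i) = marginal \<pi> u $ j"
proof -
  have "(\<Sum>i\<in>UNIV. marginal \<pi> (axis i 1) $ j * u $ i) = (\<Sum>i\<in>UNIV. if \<pi> i = j then u $ i else 0)"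
    unfolding marginal_axis by (rule sum.cong) (auto simp: axis_def)
  also have "\<dots> = marginal \<pi> u $ j"
    by (simp add: marginal_def sum.If_cases)
  finally show ?thesis .
qed

lemma B_C4_mult: "B_C4 *v u = marginals_C4 u"
  by (simp add: B_C4_def marginals_C4_def matrix_def matrix_vector_mult_def vec_eq_iff
        sum_marginal_axis split: sum.split)

lemma B_left_mult: "B_left *v u = marginals_left u"
  by (simp add: B_left_def marginals_left_def matrix_def matrix_vector_mult_def vec_eq_iff
        sum_marginal_axis split: sum.split)

lemma B_right_mult: "B_right *v u = marginals_right u"
  by (simp add: B_right_def marginals_right_def matrix_def matrix_vector_mult_def vec_eq_iff
        sum_marginal_axis split: sum.split)

definition compatible ::
  "int ^ 'n::finite ^ 'm::finite \<Rightarrow> (int ^ 'n \<Rightarrow> int ^ 'k::finite) \<Rightarrow>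
   (int ^ 'n \<Rightarrow> int ^ 'n \<Rightarrow> bool) \<Rightarrow> (int ^ 'k \<Rightarrow> int ^ 'k \<Rightarrow> bool) \<Rightarrow> bool" where
  "compatible B f R S \<longleftrightarrow>
     (\<forall>F \<in> fibers B. \<forall>u\<in>F. \<forall>v\<in>F. f u \<noteq> f v \<longrightarrow> (R u v \<longleftrightarrow> S (f u) (f v)))"


section \<open>Moves in tableau notation\<close>

definition tableau :: "'i::finite list \<Rightarrow> int ^ 'i" where
  "tableau ts = (\<Sum>t\<leftarrow>ts. axis t 1)"

definition C4_moves :: "(int ^ ('p::finite \<times> 2 \<times> 3 \<times> 'q::finite)) set" where
  "C4_moves =
     {tableau [(a1, b, c, e1),
               (a2, b, c, e2)]
    - tableau [(a1, b, c, e2),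
               (a2, b, c, e1)]
      | a1 a2 b c e1 e2. True}
   \<union> {tableau [(a1, 1, c1, e1),
               (a2, 2, c1, e2),
               (a2, 1, c2, e3),
               (a1, 2, c2, e4)]
    - tableau [(a2, 1, c1, e1),
               (a1, 2, c1, e2),
               (a1, 1, c2, e3),
               (a2, 2, c2, e4)]
      | a1 a2 c1 c2 e1 e2 e3 e4. True}
   \<union> {tableau [(a1, 1, c1, e1),
               (a2, 2, c1, e2),
               (a3, 1, c2, e2),
               (a4, 2, c2, e1)]
    - tableau [(a1, 1, c1, e2),
               (a2, 2, c1, e1),
               (a3, 1, c2, e1),
               (a4, 2, c2, e2)]
      | a1 a2 a3 a4 c1 c2 e1 e2. True}
   \<union> {tableau [(a1, 1, 1, e1),
               (a2, 1, 2, e2),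
               (a3, 1, 3, e3),
               (a2, 2, 1, e4),
               (a3, 2, 2, e5),
               (a1, 2, 3, e6)]
    - tableau [(a2, 1, 1, e1),
               (a3, 1, 2, e2),
               (a1, 1, 3, e3),
               (a1, 2, 1, e4),
               (a2, 2, 2, e5),
               (a3, 2, 3, e6)]
      | a1 a2 a3 e1 e2 e3 e4 e5 e6. True}
   \<union> {tableau [(a1, 1, 1, e1),
               (a2, 1, 2, e2),
               (a3, 1, 3, e3),
               (a4, 2, 1, e2),
               (a5, 2, 2, e3),
               (a6, 2, 3, e1)]
    - tableau [(a1, 1, 1, e2),
               (a2, 1, 2, e3),
               (a3, 1, 3, e1),
               (a4, 2, 1, e1),
               (a5, 2, 2, e2),
               (a6, 2, 3, e3)]
      | a1 a2 a3 a4 a5 a6 e1 e2 e3. True}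
   \<union> {tableau [(a, 1, c1, e),
               (a, 2, c2, e)]
    - tableau [(a, 1, c2, e),
               (a, 2, c1, e)]
      | a c1 c2 e. True}
   \<union> {tableau [(a1, 1, c1, e1),
               (a1, 2, c2, e2),
               (a2, 1, c2, e3),
               (a2, 2, c3, e1)]
    - tableau [(a1, 1, c2, e3),
               (a1, 2, c1, e1),
               (a2, 1, c3, e1),
               (a2, 2, c2, e2)]
      | a1 a2 c1 c2 c3 e1 e2 e3. True}
   \<union> {tableau [(a1, 1, c1, e1),
               (a2, 2, c2, e1),
               (a3, 1, c2, e2),
               (a1, 2, c3, e2)]
    - tableau [(a3, 1, c2, e1),
               (a1, 2, c1, e1),
               (a1, 1, c3, e2),
               (a2, 2, c2, e2)]
      | a1 a2 a3 c1 c2 c3 e1 e2. True}"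

end

theory Submission
  imports Defs
begin

text \<open>
  Two tables of a fiber \<open>F\<close> are compared in three layers: through the \<open>2 \<times> 3\<close> marginal \<open>\<xi>\<close>, then
  through the marginals \<open>\<psi>\<close> and \<open>\<psi>'\<close> lying above it, and finally as tables with the same \<open>\<psi>\<close> and
  \<open>\<psi>'\<close>. Each layer has its own group of moves.

  Tables with the same \<open>\<psi>\<close> and \<open>\<psi>'\<close> differ, for each \<open>(b, c)\<close>, by a \<open>p \<times> q\<close> table with vanishing row
  and column sums. The quadratic swaps connect them, and the preorder does not separate them, so
  that swaps can be used freely in both directions (\<open>linked_of_psi_eq\<close>). In particular rows lying in
  different cells \<open>(b, c)\<close> can be assembled at will from positive entries of \<open>\<psi>\<close> and \<open>\<psi>'\<close>
  (\<open>bring_rows_together\<close>), and a move becomes applicable as soon as its two projections are.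

  If \<open>\<xi>\<close> agrees but \<open>\<psi>\<close> does not, the difference of the \<open>\<psi>\<close> is determined by its slice at \<open>b = 1\<close>,
  a \<open>p \<times> 3\<close> array with vanishing row and column sums. Such an array contains an alternating cycle
  of length four or six (\<open>alternating_cycle\<close>), and the corresponding moves change only the first
  coordinate of some rows. The same holds for \<open>\<psi>'\<close> and the fourth coordinate.

  If \<open>\<xi>\<close> itself differs, pick a column \<open>k\<close> in which the first row of \<open>\<xi>\<close> is too large and a column
  \<open>l\<close> in which it is too small. On the left as well as on the right, one unit can be transported
  from \<open>k\<close> to \<open>l\<close> either directly or through the third column \<open>h\<close>, since there are only three
  columns (\<open>exchange\<close>). Combining a direct transport on both sides, or a direct one with an indirect
  one, gives the last three families of moves. Two indirect transports pass through the same
  column \<open>h\<close>, so that the step is the sum of two quadratic moves, from \<open>k\<close> to \<open>h\<close> and from \<open>h\<close> to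
  \<open>l\<close>, each of which is applicable alone (\<open>xi_step\<close>).

  It remains to see that these steps go down. Let \<open>v\<close> be a minimum of \<open>F\<close>. The constructions are
  symmetric: the step leading from \<open>u\<close> towards \<open>v\<close> has a counterpart, starting at \<open>v\<close> and leading
  towards \<open>u\<close>, with the opposite effect on the layer at hand. It cannot go down strictly at \<open>v\<close>, hence by
  additivity the step at \<open>u\<close> does not go up. Either one of its moves goes down strictly, or all its
  moves are reversible and \<open>u\<close> gets closer to \<open>v\<close>. By induction on the distance, every \<open>u\<close> either
  reaches something strictly smaller or is mutually reachable with \<open>v\<close>
  (\<open>descend_or_linked_minimum\<close>). As the fiber is finite, every minimum can be reached from every
  vertex, and this gives the three conditions on sinks and connectedness.
\<close>

section \<open>Marginals of tableaux\<close>

lemma marginal_add: "marginal \<pi> (u + v) = marginal \<pi> u + marginal \<pi> v"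
  by (simp add: marginal_def vec_eq_iff sum.distrib)

lemma marginal_diff: "marginal \<pi> (u - v) = marginal \<pi> u - marginal \<pi> v"
  by (simp add: marginal_def vec_eq_iff sum_subtractf)

lemma marginal_0: "marginal \<pi> 0 = 0"
  by (simp add: marginal_def vec_eq_iff)

lemma marginal_nonneg: "(\<And>i. 0 \<le> u $ i) \<Longrightarrow> 0 \<le> marginal \<pi> u $ j"
  by (simp add: marginal_def sum_nonneg)

lemma marginal_nth_bij:
  assumes "bij_betw h UNIV {i. \<pi> i = j}"
  shows "marginal \<pi> u $ j = (\<Sum>k\<in>UNIV. u $ h k)"
  using sum.reindex_bij_betw[OF assms, of "($) u"] by (simp add: marginal_def)

lemma tableau_Nil: "tableau [] = 0"
  and tableau_Cons: "tableau (t # ts) = axis t 1 + tableau ts"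
  and tableau_append: "tableau (ts @ ts') = tableau ts + tableau ts'"
  by (simp_all add: tableau_def)

lemma marginal_tableau: "marginal \<pi> (tableau ts) = tableau (map \<pi> ts)"
  by (induction ts) (simp_all add: tableau_Nil tableau_Cons marginal_0 marginal_add marginal_axis)

lemma tableau_nth_distinct:
  "distinct ts \<Longrightarrow> tableau ts $ i = (if i \<in> set ts then 1 else 0)"
  by (induction ts) (auto simp: tableau_Nil tableau_Cons axis_def)

lemmas marginal_simps =
  psi_def psi'_def phi_def phi'_def marginal_diff marginal_add marginal_tableau marginal_marginal

lemma xi_marginal: "xi = marginal (\<lambda>(a, b, c, e). (b, c))"
  by (simp add: xi_def phi_def psi_def fun_eq_iff marginal_marginal comp_def case_prod_unfold)

lemma psi_nth: "psi u $ (a, b, c) = (\<Sum>e\<in>UNIV. u $ (a, b, c, e))"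
  unfolding psi_def by (rule marginal_nth_bij) (auto intro!: bij_betwI[where g = "snd \<circ> snd \<circ> snd"])

lemma psi'_nth: "psi' u $ (b, c, e) = (\<Sum>a\<in>UNIV. u $ (a, b, c, e))"
  unfolding psi'_def by (rule marginal_nth_bij) (auto intro!: bij_betwI[where g = fst])

lemma xi_nth: "xi u $ (b, c) = (\<Sum>a\<in>UNIV. psi u $ (a, b, c))"
  unfolding xi_def phi_def comp_def
  by (rule marginal_nth_bij) (auto intro!: bij_betwI[where g = fst])

lemma xi_nth': "xi u $ (b, c) = (\<Sum>e\<in>UNIV. psi' u $ (b, c, e))"
  unfolding xi_eq phi'_def comp_def
  by (rule marginal_nth_bij) (auto intro!: bij_betwI[where g = "snd \<circ> snd"])

lemma marginals_C4_nth:
  "marginals_C4 u $ Inl (a, b) = (\<Sum>c\<in>UNIV. psi u $ (a, b, c))" (is ?ab)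
  "marginals_C4 u $ Inr (Inl (a, c)) = (\<Sum>b\<in>UNIV. psi u $ (a, b, c))" (is ?ac)
  "marginals_C4 u $ Inr (Inr (Inl (b, e))) = (\<Sum>c\<in>UNIV. psi' u $ (b, c, e))" (is ?be)
  "marginals_C4 u $ Inr (Inr (Inr (c, e))) = (\<Sum>b\<in>UNIV. psi' u $ (b, c, e))" (is ?ce)
proof -
  have "marginal (\<lambda>(a, b, c, e). (a, b)) u = marginal (\<lambda>(a, b, c). (a, b)) (psi u)"
    by (simp add: psi_def marginal_marginal comp_def case_prod_unfold)
  moreover have "\<dots> $ (a, b) = (\<Sum>c\<in>UNIV. psi u $ (a, b, c))"
    by (rule marginal_nth_bij) (auto intro!: bij_betwI[where g = "snd \<circ> snd"])
  ultimately show ?ab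
    by (simp add: marginals_C4_def)
  have "marginal (\<lambda>(a, b, c, e). (a, c)) u = marginal (\<lambda>(a, b, c). (a, c)) (psi u)"
    by (simp add: psi_def marginal_marginal comp_def case_prod_unfold)
  moreover have "\<dots> $ (a, c) = (\<Sum>b\<in>UNIV. psi u $ (a, b, c))"
    by (rule marginal_nth_bij) (auto intro!: bij_betwI[where g = "fst \<circ> snd"])
  ultimately show ?ac
    by (simp add: marginals_C4_def)
  have "marginal (\<lambda>(a, b, c, e). (b, e)) u = marginal (\<lambda>(b, c, e). (b, e)) (psi' u)"
    by (simp add: psi'_def marginal_marginal comp_def case_prod_unfold)
  moreover have "\<dots> $ (b, e) = (\<Sum>c\<in>UNIV. psi' u $ (b, c, e))"
    by (rule marginal_nth_bij) (auto intro!: bij_betwI[where g = "fst \<circ> snd"])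
  ultimately show ?be
    by (simp add: marginals_C4_def)
  have "marginal (\<lambda>(a, b, c, e). (c, e)) u = marginal (\<lambda>(b, c, e). (c, e)) (psi' u)"
    by (simp add: psi'_def marginal_marginal comp_def case_prod_unfold)
  moreover have "\<dots> $ (c, e) = (\<Sum>b\<in>UNIV. psi' u $ (b, c, e))"
    by (rule marginal_nth_bij) (auto intro!: bij_betwI[where g = fst])
  ultimately show ?ce
    by (simp add: marginals_C4_def)
qed

section \<open>The moves\<close>

definition signed_moves :: "(int ^ ('p::finite \<times> 2 \<times> 3 \<times> 'q::finite)) set" where
  "signed_moves = C4_moves \<union> uminus ` C4_moves"

lemma signed_moves_uminus: "m \<in> signed_moves \<Longrightarrow> - m \<in> signed_moves"
  by (auto simp: signed_moves_def)

lemma signed_moves_swap: "u - v \<in> signed_moves \<Longrightarrow> v - u \<in> signed_moves"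
  using signed_moves_uminus[of "u - v"] by simp

lemma C4_moves_intros:
  "tableau [(a1, b, c, e1), (a2, b, c, e2)]
     - tableau [(a1, b, c, e2), (a2, b, c, e1)] \<in> C4_moves"
  "tableau [(a1, 1, c1, e1), (a2, 2, c1, e2), (a2, 1, c2, e3), (a1, 2, c2, e4)]
     - tableau [(a2, 1, c1, e1), (a1, 2, c1, e2), (a1, 1, c2, e3), (a2, 2, c2, e4)] \<in> C4_moves"
  "tableau [(a1, 1, c1, e1), (a2, 2, c1, e2), (a3, 1, c2, e2), (a4, 2, c2, e1)]
     - tableau [(a1, 1, c1, e2), (a2, 2, c1, e1), (a3, 1, c2, e1), (a4, 2, c2, e2)] \<in> C4_moves"
  "tableau [(a1, 1, 1, e1), (a2, 1, 2, e2), (a3, 1, 3, e3),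
            (a2, 2, 1, e4), (a3, 2, 2, e5), (a1, 2, 3, e6)]
     - tableau [(a2, 1, 1, e1), (a3, 1, 2, e2), (a1, 1, 3, e3),
                (a1, 2, 1, e4), (a2, 2, 2, e5), (a3, 2, 3, e6)] \<in> C4_moves"
  "tableau [(a1, 1, 1, e1), (a2, 1, 2, e2), (a3, 1, 3, e3),
            (a4, 2, 1, e2), (a5, 2, 2, e3), (a6, 2, 3, e1)]
     - tableau [(a1, 1, 1, e2), (a2, 1, 2, e3), (a3, 1, 3, e1),
                (a4, 2, 1, e1), (a5, 2, 2, e2), (a6, 2, 3, e3)] \<in> C4_moves"
  "tableau [(a, 1, c1, e), (a, 2, c2, e)]
     - tableau [(a, 1, c2, e), (a, 2, c1, e)] \<in> C4_moves"
  "tableau [(a1, 1, c1, e1), (a1, 2, c2, e2), (a2, 1, c2, e3), (a2, 2, c3, e1)]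
     - tableau [(a1, 1, c2, e3), (a1, 2, c1, e1), (a2, 1, c3, e1), (a2, 2, c2, e2)] \<in> C4_moves"
  "tableau [(a1, 1, c1, e1), (a2, 2, c2, e1), (a3, 1, c2, e2), (a1, 2, c3, e2)]
     - tableau [(a3, 1, c2, e1), (a1, 2, c1, e1), (a1, 1, c3, e2), (a2, 2, c2, e2)] \<in> C4_moves"
  unfolding C4_moves_def
  subgoal by (rule UnI1, rule UnI1, rule UnI1, rule UnI1, rule UnI1, rule UnI1, rule UnI1, intro CollectI exI conjI TrueI, rule refl)
  subgoal by (rule UnI1, rule UnI1, rule UnI1, rule UnI1, rule UnI1, rule UnI1, rule UnI2, intro CollectI exI conjI TrueI, rule refl)
  subgoal by (rule UnI1, rule UnI1, rule UnI1, rule UnI1, rule UnI1, rule UnI2, intro CollectI exI conjI TrueI, rule refl)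
  subgoal by (rule UnI1, rule UnI1, rule UnI1, rule UnI1, rule UnI2, intro CollectI exI conjI TrueI, rule refl)
  subgoal by (rule UnI1, rule UnI1, rule UnI1, rule UnI2, intro CollectI exI conjI TrueI, rule refl)
  subgoal by (rule UnI1, rule UnI1, rule UnI2, intro CollectI exI conjI TrueI, rule refl)
  subgoal by (rule UnI1, rule UnI2, intro CollectI exI conjI TrueI, rule refl)
  subgoal by (rule UnI2, intro CollectI exI conjI TrueI, rule refl)
  done

lemma zero_signed_move: "(0 :: int ^ ('p::finite \<times> 2 \<times> 3 \<times> 'q::finite)) \<in> signed_moves"
proof -
  obtain a :: 'p and b :: 2 and c :: 3 and e :: 'q where True by blast
  have "(0 :: int ^ ('p \<times> 2 \<times> 3 \<times> 'q)) \<in> C4_moves"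
    using C4_moves_intros(1)[of a b c e a e] by simp
  then show ?thesis
    by (simp add: signed_moves_def)
qed

lemma marginals_C4_add: "marginals_C4 (u + v) = marginals_C4 u + marginals_C4 v"
  by (simp add: marginals_C4_def vec_eq_iff marginal_add split: sum.split)

lemma marginals_C4_diff: "marginals_C4 (u - v) = marginals_C4 u - marginals_C4 v"
  by (simp add: marginals_C4_def vec_eq_iff marginal_diff split: sum.split)

lemma tableau_eqI: "mset ts = mset ts' \<Longrightarrow> tableau ts = tableau ts'"
  unfolding tableau_def by (metis mset_map sum_mset_sum_list)

lemma marginals_C4_eqI:
  assumes "mset (map (\<lambda>(a, b, c, e). (a, b)) ts) = mset (map (\<lambda>(a, b, c, e). (a, b)) ts')"
    and "mset (map (\<lambda>(a, b, c, e). (a, c)) ts) = mset (map (\<lambda>(a, b, c, e). (a, c)) ts')"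
    and "mset (map (\<lambda>(a, b, c, e). (b, e)) ts) = mset (map (\<lambda>(a, b, c, e). (b, e)) ts')"
    and "mset (map (\<lambda>(a, b, c, e). (c, e)) ts) = mset (map (\<lambda>(a, b, c, e). (c, e)) ts')"
  shows "marginals_C4 (tableau ts) = marginals_C4 (tableau ts')"
  using assms[THEN tableau_eqI]
  by (simp add: marginals_C4_def vec_eq_iff marginal_tableau split: sum.split)

lemma C4_moves_kernel: "m \<in> C4_moves \<Longrightarrow> marginals_C4 m = 0"
  unfolding C4_moves_def
  by (elim UnE CollectE exE conjE; hypsubst; unfold marginals_C4_diff right_minus_eq;
      rule marginals_C4_eqI; simp add: add_mset_commute)

lemma signed_moves_kernel:
  assumes "m \<in> signed_moves"
  shows "marginals_C4 m = 0"
proof -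
  have "marginals_C4 (- n) = - marginals_C4 n" for n :: "int ^ ('a \<times> 2 \<times> 3 \<times> 'b)"
    using marginals_C4_diff[of n n] marginals_C4_diff[of "n - n" n] by simp
  then show ?thesis
    using assms by (auto simp: signed_moves_def C4_moves_kernel)
qed


section \<open>Sign patterns of zero-sum arrays\<close>

lemma zero_sum_sign_change:
  fixes f :: "'i::finite \<Rightarrow> int"
  assumes "sum f UNIV = 0"
  shows "0 < f x \<Longrightarrow> \<exists>y. f y < 0" and "f x < 0 \<Longrightarrow> \<exists>y. 0 < f y"
proof -
  have *: "\<exists>y. g y < 0" if "sum g UNIV = 0" "0 < g x" for g :: "'i \<Rightarrow> int"
  proof (rule ccontr)
    assume "\<nexists>y. g y < 0"
    then have "0 < sum g UNIV"
      using that(2) by (intro sum_pos2[of UNIV x]) (auto simp: not_less)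
    with that(1) show False by simp
  qed
  show "0 < f x \<Longrightarrow> \<exists>y. f y < 0"
    using *[of f] assms by blast
  show "f x < 0 \<Longrightarrow> \<exists>y. 0 < f y"
    using *[of "\<lambda>y. - f y"] assms by (auto simp: sum_negf)
qed

text \<open>
  Starting at a positive entry, walk alternately along a row to a negative entry and along a column
  to a positive entry. With three columns a repetition occurs after at most three rounds, which
  leaves a cycle through two or three columns; a cycle through three columns can be rotated to start
  at column 1 and then has one of two orientations.
\<close>

lemma alternating_cycle:
  fixes D :: "'r::finite \<Rightarrow> 3 \<Rightarrow> int"
  assumes rows: "\<And>r. (\<Sum>c\<in>UNIV. D r c) = 0"
    and cols: "\<And>c. (\<Sum>r\<in>UNIV. D r c) = 0"
    and nonzero: "D r0 c0 \<noteq> 0"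
  obtains
    (square) r1 r2 c1 c2 where
      "D r1 c1 < 0" "D r2 c1 > 0" "D r2 c2 < 0" "D r1 c2 > 0"
  | (hexagon) r1 r2 r3 where
      "D r1 1 < 0" "D r2 1 > 0" "D r2 2 < 0" "D r3 2 > 0" "D r3 3 < 0" "D r1 3 > 0"
  | (reverse_hexagon) r1 r2 r3 where
      "D r1 1 > 0" "D r2 1 < 0" "D r2 2 > 0" "D r3 2 < 0" "D r3 3 > 0" "D r1 3 < 0"
proof -
  note row_sign = zero_sum_sign_change[OF rows]
  note col_sign = zero_sum_sign_change[OF cols]
  obtain r1 c1 where p1: "D r1 c1 > 0"
    using nonzero row_sign(2)[of r0 c0] by (metis linorder_neqE)
  obtain c2 where n1: "D r1 c2 < 0"
    using row_sign(1)[OF p1] by blast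
  obtain r2 where p2: "D r2 c2 > 0"
    using col_sign(2)[OF n1] by blast
  obtain c3 where n2: "D r2 c3 < 0"
    using row_sign(1)[OF p2] by blast
  obtain r3 where p3: "D r3 c3 > 0"
    using col_sign(2)[OF n2] by blast
  obtain c4 where n3: "D r3 c4 < 0"
    using row_sign(1)[OF p3] by blast
  have ne: "c1 \<noteq> c2" "c2 \<noteq> c3" "c3 \<noteq> c4"
    using p1 n1 p2 n2 p3 n3 by auto
  consider "c3 = c1" | "c4 = c2" | "c3 \<noteq> c1" "c4 = c1"
    using ne exhaust_3[of c1] exhaust_3[of c2] exhaust_3[of c3] exhaust_3[of c4] by metis
  then show thesis
  proof cases
    case 1
    then show thesis
      using square[of r2 c1 r1 c2] p1 n1 p2 n2 by simp
  next
    case 2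
    then show thesis
      using square[of r3 c2 r2 c3] p2 n2 p3 n3 by simp
  next
    case 3
    note signs = p1 n1 p2 n2 p3 n3[unfolded \<open>c4 = c1\<close>]
    consider "c1 = 1" "c2 = 2" "c3 = 3" | "c1 = 2" "c2 = 3" "c3 = 1" | "c1 = 3" "c2 = 1" "c3 = 2"
      | "c1 = 1" "c2 = 3" "c3 = 2" | "c1 = 3" "c2 = 2" "c3 = 1" | "c1 = 2" "c2 = 1" "c3 = 3"
      using ne 3 exhaust_3[of c1] exhaust_3[of c2] exhaust_3[of c3] by metis
    then show thesis
      by cases (use signs hexagon[of r3 r1 r2] hexagon[of r2 r3 r1] hexagon[of r1 r2 r3]
          reverse_hexagon[of r1 r3 r2] reverse_hexagon[of r3 r2 r1] reverse_hexagon[of r2 r1 r3]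
          in simp_all)
  qed
qed

text \<open>
  An entry \<open>(a, a', b, c)\<close> of \<open>K\<close> stands for moving one unit from \<open>(a, b, c)\<close> to \<open>(a', b, c)\<close>. Since
  \<open>K\<close> meets every cell \<open>(b, c)\<close> at most once, the fourth coordinates of the rows of the move are given
  by an arbitrary function \<open>\<epsilon>\<close> of the cell; this freedom allows the same rearrangement to be lifted
  to different tables.
\<close>

lemma left_rearrangement:
  fixes D :: "'p::finite \<Rightarrow> 2 \<Rightarrow> 3 \<Rightarrow> int"
  assumes rows: "\<And>a. (\<Sum>c\<in>UNIV. D a 1 c) = 0"
    and opposite: "\<And>a c. D a 2 c = - D a 1 c"
    and cols: "\<And>c. (\<Sum>a\<in>UNIV. D a 1 c) = 0"
    and nonzero: "D a0 b0 c0 \<noteq> 0"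
  obtains K :: "('p \<times> 'p \<times> 2 \<times> 3) list" where
    "K \<noteq> []" "distinct (map (\<lambda>(a, a', b, c). (b, c)) K)"
    "\<And>a a' b c. (a, a', b, c) \<in> set K \<Longrightarrow> D a b c < 0 \<and> 0 < D a' b c"
    "\<And>\<epsilon> :: 2 \<Rightarrow> 3 \<Rightarrow> 'q::finite.
       tableau (map (\<lambda>(a, a', b, c). (a', b, c, \<epsilon> b c)) K)
       - tableau (map (\<lambda>(a, a', b, c). (a, b, c, \<epsilon> b c)) K) \<in> signed_moves"
proof -
  have "D a0 1 c0 \<noteq> 0"
    using nonzero exhaust_2[of b0] by (auto simp: opposite)
  with rows cols show thesis
  proof (cases rule: alternating_cycle[of "\<lambda>a. D a 1"])
    case (square a1 a2 c1 c2)
    let ?K = "[(a1, a2, 1, c1), (a2, a1, 2, c1), (a2, a1, 1, c2), (a1, a2, 2, c2)]"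
    show thesis
    proof (rule that[of ?K])
      show "tableau (map (\<lambda>(a, a', b, c). (a', b, c, \<epsilon> b c)) ?K)
         - tableau (map (\<lambda>(a, a', b, c). (a, b, c, \<epsilon> b c)) ?K) \<in> signed_moves"
        for \<epsilon> :: "2 \<Rightarrow> 3 \<Rightarrow> 'q"
        unfolding list.map prod.case
        by (rule signed_moves_swap) (simp only: signed_moves_def C4_moves_intros UnI1)
    qed (use square in \<open>auto simp: opposite\<close>)
  next
    case (hexagon a1 a2 a3)
    let ?K = "[(a1, a2, 1, 1), (a2, a3, 1, 2), (a3, a1, 1, 3),
               (a2, a1, 2, 1), (a3, a2, 2, 2), (a1, a3, 2, 3)]"
    show thesis
    proof (rule that[of ?K])
      show "tableau (map (\<lambda>(a, a', b, c). (a', b, c, \<epsilon> b c)) ?K)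
         - tableau (map (\<lambda>(a, a', b, c). (a, b, c, \<epsilon> b c)) ?K) \<in> signed_moves"
        for \<epsilon> :: "2 \<Rightarrow> 3 \<Rightarrow> 'q"
        unfolding list.map prod.case
        by (rule signed_moves_swap) (simp only: signed_moves_def C4_moves_intros UnI1)
    qed (use hexagon in \<open>auto simp: opposite\<close>)
  next
    case (reverse_hexagon a1 a2 a3)
    let ?K = "[(a2, a1, 1, 1), (a3, a2, 1, 2), (a1, a3, 1, 3),
               (a1, a2, 2, 1), (a2, a3, 2, 2), (a3, a1, 2, 3)]"
    show thesis
    proof (rule that[of ?K])
      show "tableau (map (\<lambda>(a, a', b, c). (a', b, c, \<epsilon> b c)) ?K)
         - tableau (map (\<lambda>(a, a', b, c). (a, b, c, \<epsilon> b c)) ?K) \<in> signed_moves"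
        for \<epsilon> :: "2 \<Rightarrow> 3 \<Rightarrow> 'q"
        unfolding list.map prod.case
        by (simp only: signed_moves_def C4_moves_intros UnI1)
    qed (use reverse_hexagon in \<open>auto simp: opposite\<close>)
  qed
qed

text \<open>
  The mirror image of the previous lemma, with the first and the fourth coordinate exchanged.
\<close>

lemma right_rearrangement:
  fixes D :: "2 \<Rightarrow> 3 \<Rightarrow> 'q::finite \<Rightarrow> int"
  assumes rows: "\<And>e. (\<Sum>c\<in>UNIV. D 1 c e) = 0"
    and opposite: "\<And>c e. D 2 c e = - D 1 c e"
    and cols: "\<And>c. (\<Sum>e\<in>UNIV. D 1 c e) = 0"
    and nonzero: "D b0 c0 e0 \<noteq> 0"
  obtains K :: "(2 \<times> 3 \<times> 'q \<times> 'q) list" where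
    "K \<noteq> []" "distinct (map (\<lambda>(b, c, e, e'). (b, c)) K)"
    "\<And>b c e e'. (b, c, e, e') \<in> set K \<Longrightarrow> D b c e < 0 \<and> 0 < D b c e'"
    "\<And>\<alpha> :: 2 \<Rightarrow> 3 \<Rightarrow> 'p::finite.
       tableau (map (\<lambda>(b, c, e, e'). (\<alpha> b c, b, c, e')) K)
       - tableau (map (\<lambda>(b, c, e, e'). (\<alpha> b c, b, c, e)) K) \<in> signed_moves"
proof -
  have "D 1 c0 e0 \<noteq> 0"
    using nonzero exhaust_2[of b0] by (auto simp: opposite)
  with rows cols show thesis
  proof (cases rule: alternating_cycle[of "\<lambda>e c. D 1 c e"])
    case (square e1 e2 c1 c2)
    let ?K = "[(1, c1, e1, e2), (2, c1, e2, e1), (1, c2, e2, e1), (2, c2, e1, e2)]"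
    show thesis
    proof (rule that[of ?K])
      show "tableau (map (\<lambda>(b, c, e, e'). (\<alpha> b c, b, c, e')) ?K)
         - tableau (map (\<lambda>(b, c, e, e'). (\<alpha> b c, b, c, e)) ?K) \<in> signed_moves"
        for \<alpha> :: "2 \<Rightarrow> 3 \<Rightarrow> 'p"
        unfolding list.map prod.case
        by (simp only: signed_moves_def C4_moves_intros UnI1)
    qed (use square in \<open>auto simp: opposite\<close>)
  next
    case (hexagon e1 e2 e3)
    let ?K = "[(1, 1, e1, e2), (1, 2, e2, e3), (1, 3, e3, e1),
               (2, 1, e2, e1), (2, 2, e3, e2), (2, 3, e1, e3)]"
    show thesis
    proof (rule that[of ?K])
      show "tableau (map (\<lambda>(b, c, e, e'). (\<alpha> b c, b, c, e')) ?K)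
         - tableau (map (\<lambda>(b, c, e, e'). (\<alpha> b c, b, c, e)) ?K) \<in> signed_moves"
        for \<alpha> :: "2 \<Rightarrow> 3 \<Rightarrow> 'p"
        unfolding list.map prod.case
        by (rule signed_moves_swap) (simp only: signed_moves_def C4_moves_intros UnI1)
    qed (use hexagon in \<open>auto simp: opposite\<close>)
  next
    case (reverse_hexagon e1 e2 e3)
    let ?K = "[(1, 1, e2, e1), (1, 2, e3, e2), (1, 3, e1, e3),
               (2, 1, e1, e2), (2, 2, e2, e3), (2, 3, e3, e1)]"
    show thesis
    proof (rule that[of ?K])
      show "tableau (map (\<lambda>(b, c, e, e'). (\<alpha> b c, b, c, e')) ?K)
         - tableau (map (\<lambda>(b, c, e, e'). (\<alpha> b c, b, c, e)) ?K) \<in> signed_moves"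
        for \<alpha> :: "2 \<Rightarrow> 3 \<Rightarrow> 'p"
        unfolding list.map prod.case
        by (simp only: signed_moves_def C4_moves_intros UnI1)
    qed (use reverse_hexagon in \<open>auto simp: opposite\<close>)
  qed
qed

text \<open>
  Some row \<open>r\<close> loses in column \<open>k\<close> and some row \<open>s\<close> gains in column \<open>l\<close>. If \<open>r\<close> does not gain in \<open>l\<close>
  and \<open>s\<close> does not lose in \<open>k\<close>, then the vanishing row sums of the difference force \<open>r\<close> to gain and
  \<open>s\<close> to lose in the only remaining column \<open>h\<close>. Losses make the entries at \<open>b = 1\<close> positive, and gains
  those at \<open>b = 2\<close>.
\<close>

lemma exchange:
  fixes y y' :: "'r::finite \<Rightarrow> 2 \<Rightarrow> 3 \<Rightarrow> int"
  assumes nonneg: "\<And>r b c. 0 \<le> y' r b c"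
    and rows: "\<And>r. (\<Sum>c\<in>UNIV. y r 1 c) = (\<Sum>c\<in>UNIV. y' r 1 c)"
    and cols: "\<And>r c. y r 1 c + y r 2 c = y' r 1 c + y' r 2 c"
    and dec: "(\<Sum>r\<in>UNIV. y' r 1 k) < (\<Sum>r\<in>UNIV. y r 1 k)"
    and inc: "(\<Sum>r\<in>UNIV. y r 1 l) < (\<Sum>r\<in>UNIV. y' r 1 l)"
    and three: "UNIV = {k, h, l}" "k \<noteq> h" "h \<noteq> l" "k \<noteq> l"
  shows "(\<exists>r. 0 < y r 1 k \<and> 0 < y r 2 l) \<or>
    (\<exists>r s. 0 < y r 1 k \<and> 0 < y r 2 h \<and> 0 < y s 1 h \<and> 0 < y s 2 l)"
proof -
  define d where "d r c = y' r 1 c - y r 1 c" for r c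
  have d_row: "d r k + d r h + d r l = 0" for r
  proof -
    have "(\<Sum>c\<in>UNIV. f c) = f k + f h + f l" for f :: "3 \<Rightarrow> int"
      unfolding three(1) using three(2-) by simp
    with rows[of r] show ?thesis
      by (simp add: d_def)
  qed
  have neg: "0 < y r 1 c" if "d r c < 0" for r c
    using that nonneg[of r 1 c] by (simp add: d_def)
  have pos: "0 < y r 2 c" if "0 < d r c" for r c
    using that nonneg[of r 2 c] cols[of r c] by (simp add: d_def)
  obtain r where r: "d r k < 0"
    using dec sum_mono[of UNIV "\<lambda>r. y r 1 k" "\<lambda>r. y' r 1 k"]
    by (force simp: d_def not_less)
  obtain s where s: "0 < d s l"
    using inc sum_mono[of UNIV "\<lambda>r. y' r 1 l" "\<lambda>r. y r 1 l"]
    by (force simp: d_def not_less)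
  show ?thesis
  proof (cases "0 < d r l \<or> d s k < 0")
    case True
    then show ?thesis
      using r s neg pos by blast
  next
    case False
    then have "0 < d r h" "d s h < 0"
      using r s d_row[of r] d_row[of s] by auto
    then show ?thesis
      using r s neg pos by blast
  qed
qed

section \<open>Distance of tables\<close>

definition l1_norm :: "int ^ 'i::finite \<Rightarrow> int" where
  "l1_norm D = (\<Sum>i\<in>UNIV. \<bar>D $ i\<bar>)"

lemma l1_norm_nonneg: "0 \<le> l1_norm D"
  by (simp add: l1_norm_def sum_nonneg)

lemma tableau_nonneg: "0 \<le> tableau ts $ i"
  by (induction ts) (auto simp: tableau_Nil tableau_Cons axis_def)

lemma sum_tableau: "(\<Sum>i\<in>UNIV. tableau ts $ i) = int (length ts)"
  by (induction ts) (simp_all add: tableau_Nil tableau_Cons sum.distrib axis_def)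

text \<open>
  A rearrangement that agrees in sign with the difference \<open>D\<close> to the target shortens it by its full
  length.
\<close>

lemma l1_norm_decrease:
  assumes "distinct ts" "distinct ts'"
    and neg: "\<And>i. i \<in> set ts \<Longrightarrow> D $ i < 0"
    and pos: "\<And>i. i \<in> set ts' \<Longrightarrow> 0 < D $ i"
  shows "l1_norm (D - (tableau ts' - tableau ts)) = l1_norm D - int (length ts) - int (length ts')"
proof -
  have "\<bar>(D - (tableau ts' - tableau ts)) $ i\<bar> = \<bar>D $ i\<bar> - tableau ts $ i - tableau ts' $ i" for i
    using neg[of i] pos[of i] assms(1,2) by (auto simp: tableau_nth_distinct)
  then show ?thesis
    by (simp add: l1_norm_def sum_subtractf sum_tableau)
qed

lemma l1_norm_diff_tableau: "l1_norm (D - tableau ts) \<le> l1_norm D + int (length ts)"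
proof -
  have "\<bar>(D - tableau ts) $ i\<bar> \<le> \<bar>D $ i\<bar> + tableau ts $ i" for i
    using tableau_nonneg[of ts i] by simp
  then have "l1_norm (D - tableau ts) \<le> (\<Sum>i\<in>UNIV. \<bar>D $ i\<bar> + tableau ts $ i)"
    unfolding l1_norm_def by (rule sum_mono)
  then show ?thesis
    by (simp add: l1_norm_def sum.distrib sum_tableau)
qed

lemma add_move_nonneg:
  assumes "\<And>i. 0 \<le> u $ i" "distinct ts" "\<And>t. t \<in> set ts \<Longrightarrow> 0 < u $ t"
  shows "0 \<le> (u + (tableau ts' - tableau ts)) $ i"
  using assms(1)[of i] assms(3)[of i] tableau_nonneg[of ts' i]
  by (auto simp: tableau_nth_distinct[OF assms(2)] split: if_splits)


section \<open>Linked vertices of a fiber\<close>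

definition cell :: "'p \<times> 2 \<times> 3 \<times> 'q \<Rightarrow> 2 \<times> 3" where
  "cell = (\<lambda>(a, b, c, e). (b, c))"

text \<open>
  What the compatibility requirements provide for a single fiber: the preorder on the fiber is
  governed by \<open>\<xi>\<close> as long as \<open>\<xi>\<close> changes, and does not see differences in the common kernel of \<open>\<psi>\<close> and
  \<open>\<psi>'\<close>.
\<close>

locale C4_fiber =
  fixes R :: "int ^ ('p::finite \<times> 2 \<times> 3 \<times> 'q::finite) \<Rightarrow> int ^ ('p \<times> 2 \<times> 3 \<times> 'q) \<Rightarrow> bool"
    and A :: "int ^ (2 \<times> 3) \<Rightarrow> int ^ (2 \<times> 3) \<Rightarrow> bool"
    and F :: "(int ^ ('p \<times> 2 \<times> 3 \<times> 'q)) set"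
  assumes preorder_R: "additive_preorder R"
    and preorder_A: "additive_preorder A"
    and F_fiber: "F \<in> fibers B_C4"
    and compatible_xi: "compatible B_C4 xi R A"
    and R_of_psi_eq: "\<And>u v. psi u = psi v \<Longrightarrow> psi' u = psi' v \<Longrightarrow> R u v"
begin

lemma R_refl: "R u u"
  and R_trans: "R u v \<Longrightarrow> R v w \<Longrightarrow> R u w"
  and R_total: "R u v \<or> R v u"
  using preorder_R by (auto simp: additive_preorder_def reflp_def intro: transpE)

lemma R_add_cancel: "R (u + w) (v + w) \<longleftrightarrow> R u v"
proof
  assume "R (u + w) (v + w)"
  then have "R (u + w + - w) (v + w + - w)"
    using preorder_R unfolding additive_preorder_def by blast
  then show "R u v" by simp
qed (use preorder_R in \<open>simp add: additive_preorder_def\<close>)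

lemma R_add_right: "R u (u + m) \<longleftrightarrow> R 0 m"
  using R_add_cancel[of 0 u m] by (simp add: add.commute)

lemma R_add_left: "R (u + m) u \<longleftrightarrow> R m 0"
  using R_add_cancel[of m u 0] by (simp add: add.commute)

lemma R_negative: "R (- m) 0 \<longleftrightarrow> R 0 m"
  using R_add_cancel[of "- m" m 0] by simp

lemma F_nonneg: "u \<in> F \<Longrightarrow> 0 \<le> u $ i"
  using F_fiber unfolding fibers_def fiber_def by blast

lemma F_marginals: "u \<in> F \<Longrightarrow> v \<in> F \<Longrightarrow> marginals_C4 u = marginals_C4 v"
  using F_fiber by (auto simp: fibers_def fiber_def B_C4_mult)

lemma F_add:
  "u \<in> F \<Longrightarrow> m \<in> signed_moves \<Longrightarrow> (\<And>i. 0 \<le> (u + m) $ i) \<Longrightarrow> u + m \<in> F"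
  using F_fiber
  by (auto simp: fibers_def fiber_def B_C4_mult marginals_C4_add signed_moves_kernel)

lemma F_psi_nonneg: "u \<in> F \<Longrightarrow> 0 \<le> psi u $ i" "u \<in> F \<Longrightarrow> 0 \<le> psi' u $ j"
  unfolding psi_def psi'_def by (rule marginal_nonneg, erule F_nonneg)+

lemma F_psi_sums:
  assumes "u \<in> F" "v \<in> F"
  shows "(\<Sum>c\<in>UNIV. psi u $ (a, b, c)) = (\<Sum>c\<in>UNIV. psi v $ (a, b, c))"
    and "psi u $ (a, 1, c) + psi u $ (a, 2, c) = psi v $ (a, 1, c) + psi v $ (a, 2, c)"
    and "(\<Sum>c\<in>UNIV. psi' u $ (b, c, e)) = (\<Sum>c\<in>UNIV. psi' v $ (b, c, e))"
    and "psi' u $ (1, c, e) + psi' u $ (2, c, e) = psi' v $ (1, c, e) + psi' v $ (2, c, e)"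
  using marginals_C4_nth(1)[of u a b] marginals_C4_nth(1)[of v a b]
    marginals_C4_nth(2)[of u a c] marginals_C4_nth(2)[of v a c]
    marginals_C4_nth(3)[of u b e] marginals_C4_nth(3)[of v b e]
    marginals_C4_nth(4)[of u c e] marginals_C4_nth(4)[of v c e]
  by (simp_all add: F_marginals[OF assms] sum_2)

abbreviation E where "E \<equiv> move_graph R C4_moves F"

abbreviation linked where "linked u v \<equiv> (u, v) \<in> mutually_reachable F E"

lemma linked_in_F: "linked u v \<Longrightarrow> u \<in> F \<and> v \<in> F"
  by (simp add: mutually_reachable_def)

lemma linked_refl: "u \<in> F \<Longrightarrow> linked u u"
  by (simp add: mutually_reachable_def)

lemma linked_trans: "linked u v \<Longrightarrow> linked v w \<Longrightarrow> linked u w"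
  by (auto simp: mutually_reachable_def)

lemma path_descends: "(u, v) \<in> E\<^sup>* \<Longrightarrow> R u v"
  by (induction rule: rtrancl_induct) (auto simp: move_graph_def intro: R_refl R_trans)

lemma path_in_F: "(u, v) \<in> E\<^sup>* \<Longrightarrow> u \<in> F \<Longrightarrow> v \<in> F"
  by (induction rule: rtrancl_induct) (auto simp: move_graph_def)

lemma linked_R: "linked u v \<Longrightarrow> R u v"
  by (simp add: mutually_reachable_def path_descends)

lemma move_edge:
  "u \<in> F \<Longrightarrow> u + m \<in> F \<Longrightarrow> m \<in> signed_moves \<Longrightarrow> R 0 m \<Longrightarrow> (u, u + m) \<in> E"
  by (simp add: move_graph_def signed_moves_def R_add_right)

lemma linked_move:
  assumes "u \<in> F" "u + m \<in> F" "m \<in> signed_moves" "R 0 m" "R m 0"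
  shows "linked u (u + m)"
proof -
  have "(u + m, u + m + - m) \<in> E"
    using assms R_negative[of "- m"] by (intro move_edge) (auto intro: signed_moves_uminus)
  then show ?thesis
    using move_edge[OF assms(1-4)] assms by (auto simp: mutually_reachable_def)
qed

definition can_descend where
  "can_descend u \<longleftrightarrow> (\<exists>w. (u, w) \<in> E\<^sup>* \<and> \<not> R w u)"

lemma can_descend_linked:
  assumes "linked u w" "can_descend w"
  shows "can_descend u"
proof -
  obtain z where "(w, z) \<in> E\<^sup>*" "\<not> R z w"
    using assms(2) by (auto simp: can_descend_def)
  then show ?thesis
    unfolding can_descend_def using assms(1) linked_R[OF assms(1)]
    by (auto simp: mutually_reachable_def intro!: exI[of _ z] intro: R_trans)
qed

lemma can_descend_move:
  assumes "u \<in> F" "u + m \<in> F" "m \<in> signed_moves" "\<not> R m 0"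
  shows "can_descend u"
proof -
  have "(u, u + m) \<in> E"
    using assms R_total by (intro move_edge) auto
  then show ?thesis
    using assms(4) by (auto simp: can_descend_def R_add_left)
qed

text \<open>
  Swaps preserve \<open>\<psi>\<close> and \<open>\<psi>'\<close>, hence they are edges in both directions.
\<close>

lemma linked_swap:
  assumes u: "u \<in> F" and pos: "0 < u $ (a, b, c, e)" "0 < u $ (a', b, c, e')"
    and ne: "a \<noteq> a'" "e \<noteq> e'"
  defines "m \<equiv> tableau [(a, b, c, e'), (a', b, c, e)] - tableau [(a, b, c, e), (a', b, c, e')]"
  shows "linked u (u + m)" "psi (u + m) = psi u" "psi' (u + m) = psi' u"
proof -
  have m: "m \<in> signed_moves"
    by (simp only: m_def signed_moves_def C4_moves_intros UnI1)
  have nonneg: "0 \<le> (u + m) $ i" for i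
    unfolding m_def using pos ne by (intro add_move_nonneg F_nonneg[OF u]) auto
  show psi: "psi (u + m) = psi u"
    by (simp add: m_def marginal_simps)
  show psi': "psi' (u + m) = psi' u"
    by (simp add: m_def marginal_simps tableau_eqI add_mset_commute)
  have "R 0 m" "R m 0"
    using R_of_psi_eq[OF psi psi'] R_of_psi_eq[OF psi[symmetric] psi'[symmetric]]
    by (simp_all only: R_add_right R_add_left)
  then show "linked u (u + m)"
    using u m nonneg by (intro linked_move F_add)
qed

lemma bring_row_together:
  assumes u: "u \<in> F" and pos: "0 < psi u $ (a, b, c)" "0 < psi' u $ (b, c, e)"
  obtains w where "linked u w" "psi w = psi u" "psi' w = psi' u" "0 < w $ (a, b, c, e)"
    "\<And>t. cell t \<noteq> (b, c) \<Longrightarrow> w $ t = u $ t"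
proof (cases "0 < u $ (a, b, c, e)")
  case True
  then show thesis
    using that[of u] u linked_refl by blast
next
  case False
  have "\<exists>e'. 0 < u $ (a, b, c, e')"
    using pos(1) sum_nonpos[of UNIV "\<lambda>e. u $ (a, b, c, e)"] by (force simp: psi_nth not_less)
  then obtain e' where e': "0 < u $ (a, b, c, e')" ..
  have "\<exists>a'. 0 < u $ (a', b, c, e)"
    using pos(2) sum_nonpos[of UNIV "\<lambda>a. u $ (a, b, c, e)"] by (force simp: psi'_nth not_less)
  then obtain a' where a': "0 < u $ (a', b, c, e)" ..
  have ne: "e \<noteq> e'" "a \<noteq> a'"
    using e' a' False by auto
  let ?m = "tableau [(a, b, c, e), (a', b, c, e')] - tableau [(a, b, c, e'), (a', b, c, e)]"
  note swap = linked_swap[OF u e' a' ne(2) ne(1)[symmetric]]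
  have "0 < (u + ?m) $ (a, b, c, e)"
    using ne F_nonneg[OF u, of "(a, b, c, e)"] by (simp add: tableau_nth_distinct)
  moreover have "(u + ?m) $ t = u $ t" if "cell t \<noteq> (b, c)" for t
    using that ne by (auto simp: tableau_nth_distinct cell_def)
  ultimately show thesis
    using that swap by blast
qed

text \<open>
  A swap that creates a row changes only entries in the cell of that row. As the rows of \<open>T\<close> lie in
  different cells, they can be created one after the other.
\<close>

lemma bring_rows_together:
  assumes u: "u \<in> F" and "distinct (map cell T)"
    and "\<And>a b c e. (a, b, c, e) \<in> set T \<Longrightarrow> 0 < psi u $ (a, b, c) \<and> 0 < psi' u $ (b, c, e)"
  shows "\<exists>w. linked u w \<and> psi w = psi u \<and> psi' w = psi' u \<and> (\<forall>t\<in>set T. 0 < w $ t)"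
  using assms(2,3)
proof (induction T)
  case Nil
  then show ?case
    using linked_refl[OF u] by auto
next
  case (Cons t T)
  obtain a b c e where t: "t = (a, b, c, e)"
    by (cases t)
  have "\<exists>w. linked u w \<and> psi w = psi u \<and> psi' w = psi' u \<and> (\<forall>t\<in>set T. 0 < w $ t)"
    by (rule Cons.IH) (use Cons.prems in auto)
  then obtain w where w:
    "linked u w" "psi w = psi u" "psi' w = psi' u" "\<forall>t\<in>set T. 0 < w $ t"
    by blast
  obtain x where x: "linked w x" "psi x = psi w" "psi' x = psi' w" "0 < x $ (a, b, c, e)"
    "\<And>t. cell t \<noteq> (b, c) \<Longrightarrow> x $ t = w $ t"
    using bring_row_together[of w a b c e] w linked_in_F[OF w(1)] Cons.prems(2)[of a b c e]
    unfolding t by auto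
  have "0 < x $ s" if "s \<in> set T" for s
  proof -
    have "cell s \<noteq> (b, c)"
      using that Cons.prems(1) by (force simp: t cell_def)
    then show ?thesis
      using x(5) w(4) that by simp
  qed
  then show ?case
    using w x linked_trans[OF w(1) x(1)] unfolding t by auto
qed

lemma apply_move:
  assumes u: "u \<in> F" and T: "distinct (map cell T)"
    and pos: "\<And>a b c e. (a, b, c, e) \<in> set T \<Longrightarrow>
      0 < psi u $ (a, b, c) \<and> 0 < psi' u $ (b, c, e)"
    and m: "tableau T' - tableau T \<in> signed_moves"
  obtains w where "linked u w" "psi w = psi u" "psi' w = psi' u"
    "w + (tableau T' - tableau T) \<in> F"
proof -
  obtain w where w: "linked u w" "psi w = psi u" "psi' w = psi' u" "\<forall>t\<in>set T. 0 < w $ t"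
    using bring_rows_together[OF u T] pos by metis
  have "w \<in> F"
    using linked_in_F[OF w(1)] ..
  then have "w + (tableau T' - tableau T) \<in> F"
    using w(4) T m by (intro F_add add_move_nonneg F_nonneg) (auto simp: distinct_map)
  with w that show thesis by blast
qed

text \<open>
  In a cell where \<open>u\<close> and \<open>v\<close> differ, the vanishing row and column sums of the difference yield three
  corners of a rectangle with alternating signs, and the swap on this rectangle brings \<open>u\<close> closer to
  \<open>v\<close>.
\<close>

lemma linked_of_psi_eq:
  assumes "u \<in> F" "v \<in> F" "psi u = psi v" "psi' u = psi' v"
  shows "linked u v"
  using assms
proof (induction "nat (l1_norm (v - u))" arbitrary: u rule: less_induct)
  case less
  show ?case
  proof (cases "u = v")
    case True
    then show ?thesis
      using less.prems linked_refl by simp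
  next
    case False
    define D where "D = v - u"
    have rows: "(\<Sum>e\<in>UNIV. D $ (a, b, c, e)) = 0" for a b c
      using psi_nth[of u a b c] psi_nth[of v a b c] less.prems(3)
      by (simp add: D_def sum_subtractf)
    have cols: "(\<Sum>a\<in>UNIV. D $ (a, b, c, e)) = 0" for b c e
      using psi'_nth[of u b c e] psi'_nth[of v b c e] less.prems(4)
      by (simp add: D_def sum_subtractf)
    obtain a0 b c e0 where "D $ (a0, b, c, e0) \<noteq> 0"
      using False by (metis D_def prod_cases4 right_minus_eq vec_eq_iff zero_index)
    then obtain a e where n: "D $ (a, b, c, e) < 0"
      using zero_sum_sign_change(1)[OF rows, of a0 b c e0] by (metis linorder_neqE)
    obtain e' where p: "0 < D $ (a, b, c, e')"
      using zero_sum_sign_change(2)[OF rows n] ..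
    obtain a' where n': "D $ (a', b, c, e') < 0"
      using zero_sum_sign_change(1)[OF cols p] ..
    have ne: "a \<noteq> a'" "e \<noteq> e'"
      using n p n' by auto
    let ?T = "[(a, b, c, e), (a', b, c, e')]" and ?T' = "[(a, b, c, e'), (a', b, c, e)]"
    let ?m = "tableau ?T' - tableau ?T"
    have pos: "0 < u $ t" if "D $ t < 0" for t
      using that F_nonneg[OF less.prems(2), of t] by (simp add: D_def)
    note swap = linked_swap[OF less.prems(1) pos[OF n] pos[OF n'] ne]
    have "l1_norm (v - (u + ?m)) < l1_norm (v - u)"
    proof -
      \<comment> \<open>The sign of \<open>D\<close> at the last entry of the swap is unknown; the loss there is at most one
        and the other three entries gain three.\<close>
      have "v - (u + ?m) = D - (tableau [(a, b, c, e')] - tableau ?T) - tableau [(a', b, c, e)]"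
        by (simp add: D_def tableau_Cons tableau_Nil)
      also have "l1_norm \<dots> \<le> l1_norm (D - (tableau [(a, b, c, e')] - tableau ?T)) + 1"
        using l1_norm_diff_tableau[of _ "[(a', b, c, e)]"] by simp
      also have "\<dots> = l1_norm D - 3 + 1"
        using n p n' ne by (subst l1_norm_decrease) auto
      finally show ?thesis
        by (simp add: D_def)
    qed
    moreover note l1_norm_nonneg[of "v - (u + ?m)"]
    ultimately have "linked (u + ?m) v"
      using less.prems swap linked_in_F[OF swap(1)] by (intro less.hyps) auto
    with swap(1) show ?thesis
      by (rule linked_trans)
  qed
qed


section \<open>Steps towards a minimum\<close>

text \<open>
  A step from a vertex linked to a minimum cannot go down strictly. By additivity this is a statement about the
  move alone, to be used at other vertices.
\<close>

lemma minimum_step: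
  assumes "is_minimum R F v" "linked v x" "x + n \<in> F"
  shows "R n 0"
proof -
  have "R (x + n) x"
  proof (rule R_trans)
    show "R (x + n) v"
      using assms(1,3) by (simp add: is_minimum_def)
    show "R v x"
      using assms(2) by (rule linked_R)
  qed
  then show ?thesis
    by (simp only: R_add_left)
qed

text \<open>
  If neither \<open>m1\<close> nor \<open>m2\<close> goes down strictly, while their sum does not go up, then both are
  reversible. Both moves have to be applicable at \<open>w\<close>, because it is not known which of them goes
  down.
\<close>

lemma descend_or_linked:
  assumes link: "linked u w"
    and moves: "m1 \<in> signed_moves" "m2 \<in> signed_moves"
    and in_F: "w + m1 \<in> F" "w + m2 \<in> F" "w + (m1 + m2) \<in> F"
    and down: "R 0 (m1 + m2)"
  shows "can_descend u \<or> linked u (w + (m1 + m2))"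
proof (cases "R m1 0 \<and> R m2 0")
  case True
  have "w \<in> F"
    using linked_in_F[OF link] ..
  have "R (m1 + m2) m1" "R (m1 + m2) m2"
    using True R_add_left[of m1 m2] R_add_left[of m2 m1] by (simp_all add: add.commute)
  with down have "R 0 m1" "R 0 m2"
    by (auto intro: R_trans[OF down])
  have "linked w (w + m1)"
    using True moves in_F \<open>w \<in> F\<close> \<open>R 0 m1\<close> by (intro linked_move) auto
  moreover have "linked (w + m1) (w + m1 + m2)"
    using True moves in_F \<open>R 0 m2\<close> by (intro linked_move) (auto simp: add.assoc)
  ultimately have "linked w (w + m1 + m2)"
    by (rule linked_trans)
  from linked_trans[OF link this] show ?thesis
    by (simp add: add.assoc)
next
  case False
  then have "can_descend w"
    using can_descend_move moves in_F linked_in_F[OF link] by blast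
  then show ?thesis
    using can_descend_linked[OF link] by blast
qed

text \<open>
  The move \<open>n\<close> at the minimum and the move \<open>m\<close> at \<open>u\<close> need not be opposite to each other; it suffices
  that their images under \<open>\<psi>\<close> and \<open>\<psi>'\<close> are.
\<close>

lemma descend_or_linked_opposite:
  assumes "is_minimum R F v" "linked v x" "x + n \<in> F"
    and "linked u w" "w + m \<in> F" "m \<in> signed_moves"
    and opposite: "psi n = - psi m" "psi' n = - psi' m"
  shows "can_descend u \<or> linked u (w + m)"
proof -
  have "R n 0"
    using assms(1-3) by (rule minimum_step)
  then have "R (n + m) m"
    using R_add_cancel[of n m 0] by simp
  moreover have "R 0 (n + m)"
    by (rule R_of_psi_eq) (use opposite in \<open>simp_all add: psi_def psi'_def marginal_add marginal_0\<close>)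
  ultimately have "R 0 m"
    by (rule R_trans[rotated])
  then show ?thesis
    using descend_or_linked[of u w m 0] assms zero_signed_move linked_in_F[OF assms(4)] by simp
qed

text \<open>
  A positive entry of \<open>\<psi>\<close> makes \<open>\<xi>\<close> positive in its cell, and hence also some entry of \<open>\<psi>'\<close> above
  that cell.
\<close>

lemma psi_pos_choice:
  assumes "u \<in> F"
  obtains \<epsilon> where "\<And>a b c. 0 < psi u $ (a, b, c) \<Longrightarrow> 0 < psi' u $ (b, c, \<epsilon> b c)"
proof -
  have "\<exists>e. 0 < psi' u $ (b, c, e)" if "0 < psi u $ (a, b, c)" for a b c
  proof -
    have "0 < xi u $ (b, c)"
      unfolding xi_nth using that by (intro sum_pos2[of UNIV a]) (auto simp: F_psi_nonneg[OF assms])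
    then show ?thesis
      using sum_nonpos[of UNIV "\<lambda>e. psi' u $ (b, c, e)"] by (force simp: xi_nth' not_less)
  qed
  from someI_ex[OF this] show thesis
    by (rule that)
qed

lemma psi'_pos_choice:
  assumes "u \<in> F"
  obtains \<alpha> where "\<And>b c e. 0 < psi' u $ (b, c, e) \<Longrightarrow> 0 < psi u $ (\<alpha> b c, b, c)"
proof -
  have "\<exists>a. 0 < psi u $ (a, b, c)" if "0 < psi' u $ (b, c, e)" for b c e
  proof -
    have "0 < xi u $ (b, c)"
      unfolding xi_nth' using that by (intro sum_pos2[of UNIV e]) (auto simp: F_psi_nonneg[OF assms])
    then show ?thesis
      using sum_nonpos[of UNIV "\<lambda>a. psi u $ (a, b, c)"] by (force simp: xi_nth not_less)
  qed
  from someI_ex[OF this] show thesis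
    by (rule that)
qed

text \<open>
  The rearrangement of \<open>\<psi> u\<close> towards \<open>\<psi> v\<close> is lifted to a move \<open>m\<close> at \<open>u\<close>, and its inverse to a move
  \<open>n\<close> at \<open>v\<close>. The two lifts use different fourth coordinates but leave \<open>\<psi>'\<close> unchanged.
\<close>

lemma psi_step:
  assumes u: "u \<in> F" and v: "is_minimum R F v" and xi: "xi u = xi v" and psi: "psi u \<noteq> psi v"
  shows "can_descend u \<or> (\<exists>w. linked u w \<and> psi' w = psi' u \<and>
    l1_norm (psi v - psi w) < l1_norm (psi v - psi u))"
proof -
  have vF: "v \<in> F"
    using v by (simp add: is_minimum_def)
  define D where "D a b c = psi v $ (a, b, c) - psi u $ (a, b, c)" for a b c
  have rows: "(\<Sum>c\<in>UNIV. D a 1 c) = 0" for a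
    using F_psi_sums(1)[OF u vF, of a 1] by (simp add: D_def sum_subtractf)
  have opposite: "D a 2 c = - D a 1 c" for a c
    using F_psi_sums(2)[OF u vF, of a c] by (simp add: D_def)
  have cols: "(\<Sum>a\<in>UNIV. D a 1 c) = 0" for c
    using xi xi_nth[of u 1 c] xi_nth[of v 1 c] by (simp add: D_def sum_subtractf)
  obtain a0 b0 c0 where "D a0 b0 c0 \<noteq> 0"
    using psi unfolding D_def by (metis prod_cases3 right_minus_eq vec_eq_iff)
  then obtain K :: "('p \<times> 'p \<times> 2 \<times> 3) list" where K:
    "K \<noteq> []" "distinct (map (\<lambda>(a, a', b, c). (b, c)) K)"
    "\<And>a a' b c. (a, a', b, c) \<in> set K \<Longrightarrow> D a b c < 0 \<and> 0 < D a' b c"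
    "\<And>\<epsilon> :: 2 \<Rightarrow> 3 \<Rightarrow> 'q.
       tableau (map (\<lambda>(a, a', b, c). (a', b, c, \<epsilon> b c)) K)
       - tableau (map (\<lambda>(a, a', b, c). (a, b, c, \<epsilon> b c)) K) \<in> signed_moves"
    using left_rearrangement[OF rows opposite cols] by blast
  define T where "T \<epsilon> = map (\<lambda>(a, a', b, c). (a, b, c, \<epsilon> b c :: 'q)) K" for \<epsilon>
  define T' where "T' \<epsilon> = map (\<lambda>(a, a', b, c). (a', b, c, \<epsilon> b c :: 'q)) K" for \<epsilon>
  let ?Y = "map (\<lambda>(a, a', b, c). (a, b, c)) K" and ?Y' = "map (\<lambda>(a, a', b, c). (a', b, c)) K"
  have psi_T: "psi (tableau (T \<epsilon>)) = tableau ?Y" "psi (tableau (T' \<epsilon>)) = tableau ?Y'"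
    and psi'_T: "psi' (tableau (T' \<epsilon>)) = psi' (tableau (T \<epsilon>))" for \<epsilon>
    by (simp_all add: T_def T'_def psi_def psi'_def marginal_tableau comp_def case_prod_unfold)
  have cells: "map cell (T \<epsilon>) = map (\<lambda>(a, a', b, c). (b, c)) K"
    "map cell (T' \<epsilon>) = map (\<lambda>(a, a', b, c). (b, c)) K" for \<epsilon>
    by (simp_all add: T_def T'_def cell_def comp_def case_prod_unfold)
  have moves: "tableau (T' \<epsilon>) - tableau (T \<epsilon>) \<in> signed_moves" for \<epsilon>
    unfolding T_def T'_def by (rule K(4))
  have u_pos: "0 < psi u $ (a, b, c)" if "D a b c < 0" for a b c
    using that F_psi_nonneg(1)[OF vF, of "(a, b, c)"] by (simp add: D_def)
  have v_pos: "0 < psi v $ (a, b, c)" if "0 < D a b c" for a b c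
    using that F_psi_nonneg(1)[OF u, of "(a, b, c)"] by (simp add: D_def)
  obtain \<epsilon> where \<epsilon>: "\<And>a b c. 0 < psi u $ (a, b, c) \<Longrightarrow> 0 < psi' u $ (b, c, \<epsilon> b c)"
    using psi_pos_choice[OF u] by blast
  obtain \<eta> where \<eta>: "\<And>a b c. 0 < psi v $ (a, b, c) \<Longrightarrow> 0 < psi' v $ (b, c, \<eta> b c)"
    using psi_pos_choice[OF vF] by blast
  let ?m = "tableau (T' \<epsilon>) - tableau (T \<epsilon>)" and ?n = "tableau (T \<eta>) - tableau (T' \<eta>)"
  have "0 < psi u $ (a, b, c) \<and> 0 < psi' u $ (b, c, e)" if "(a, b, c, e) \<in> set (T \<epsilon>)"
    for a b c e
  proof -
    from that obtain a' where "(a, a', b, c) \<in> set K" "e = \<epsilon> b c"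
      by (auto simp: T_def)
    then show ?thesis
      using K(3) u_pos \<epsilon> by blast
  qed
  note apply_move[OF u _ this moves, unfolded cells, OF K(2)]
  then obtain w where w: "linked u w" "psi w = psi u" "psi' w = psi' u" "w + ?m \<in> F"
    by blast
  have "0 < psi v $ (a, b, c) \<and> 0 < psi' v $ (b, c, e)" if "(a, b, c, e) \<in> set (T' \<eta>)"
    for a b c e
  proof -
    from that obtain a' where "(a', a, b, c) \<in> set K" "e = \<eta> b c"
      by (auto simp: T'_def)
    then show ?thesis
      using K(3) v_pos \<eta> by blast
  qed
  note apply_move[OF vF _ this signed_moves_swap[OF moves], unfolded cells, OF K(2)]
  then obtain x where x: "linked v x" "x + ?n \<in> F"
    by blast
  have "psi ?n = - psi ?m" "psi' ?n = - psi' ?m"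
    using psi_T psi'_T by (simp_all add: psi_def psi'_def marginal_diff)
  then have "can_descend u \<or> linked u (w + ?m)"
    using descend_or_linked_opposite[OF v x w(1,4) moves] by blast
  moreover have "psi' (w + ?m) = psi' u"
    using w(3) psi'_T by (simp add: psi'_def marginal_add marginal_diff)
  moreover have "l1_norm (psi v - psi (w + ?m)) < l1_norm (psi v - psi u)"
  proof -
    have "psi v - psi (w + ?m) = psi v - psi u - (tableau ?Y' - tableau ?Y)"
      using w(2) psi_T by (simp add: psi_def marginal_add marginal_diff)
    also have "l1_norm \<dots> = l1_norm (psi v - psi u) - int (length ?Y) - int (length ?Y')"
    proof (rule l1_norm_decrease)
      have "map (\<lambda>(a, b, c). (b, c)) ?Y = map (\<lambda>(a, a', b, c). (b, c)) K"
        "map (\<lambda>(a, b, c). (b, c)) ?Y' = map (\<lambda>(a, a', b, c). (b, c)) K"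
        by (simp_all add: comp_def case_prod_unfold)
      then have "distinct (map (\<lambda>(a, b, c). (b, c)) ?Y)" "distinct (map (\<lambda>(a, b, c). (b, c)) ?Y')"
        by (simp_all only: K(2))
      then show "distinct ?Y" "distinct ?Y'"
        by (simp_all only: distinct_map[of _ ?Y] distinct_map[of _ ?Y'])
    qed (use K(3) in \<open>auto simp: D_def\<close>)
    also have "\<dots> < l1_norm (psi v - psi u)"
      using K(1) by simp
    finally show ?thesis .
  qed
  ultimately show ?thesis
    by blast
qed

text \<open>
  The mirror image of the previous lemma, with \<open>\<psi>\<close> and \<open>\<psi>'\<close> exchanged.
\<close>

lemma psi'_step:
  assumes u: "u \<in> F" and v: "is_minimum R F v" and xi: "xi u = xi v" and psi': "psi' u \<noteq> psi' v"
  shows "can_descend u \<or> (\<exists>w. linked u w \<and> psi w = psi u \<and>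
    l1_norm (psi' v - psi' w) < l1_norm (psi' v - psi' u))"
proof -
  have vF: "v \<in> F"
    using v by (simp add: is_minimum_def)
  define D where "D b c e = psi' v $ (b, c, e) - psi' u $ (b, c, e)" for b c e
  have rows: "(\<Sum>c\<in>UNIV. D 1 c e) = 0" for e
    using F_psi_sums(3)[OF u vF, of 1 e] by (simp add: D_def sum_subtractf)
  have opposite: "D 2 c e = - D 1 c e" for c e
    using F_psi_sums(4)[OF u vF, of c e] by (simp add: D_def)
  have cols: "(\<Sum>e\<in>UNIV. D 1 c e) = 0" for c
    using xi xi_nth'[of u 1 c] xi_nth'[of v 1 c] by (simp add: D_def sum_subtractf)
  obtain b0 c0 e0 where "D b0 c0 e0 \<noteq> 0"
    using psi' unfolding D_def by (metis prod_cases3 right_minus_eq vec_eq_iff)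
  then obtain K :: "(2 \<times> 3 \<times> 'q \<times> 'q) list" where K:
    "K \<noteq> []" "distinct (map (\<lambda>(b, c, e, e'). (b, c)) K)"
    "\<And>b c e e'. (b, c, e, e') \<in> set K \<Longrightarrow> D b c e < 0 \<and> 0 < D b c e'"
    "\<And>\<alpha> :: 2 \<Rightarrow> 3 \<Rightarrow> 'p.
       tableau (map (\<lambda>(b, c, e, e'). (\<alpha> b c, b, c, e')) K)
       - tableau (map (\<lambda>(b, c, e, e'). (\<alpha> b c, b, c, e)) K) \<in> signed_moves"
    using right_rearrangement[OF rows opposite cols] by blast
  define T where "T \<alpha> = map (\<lambda>(b, c, e, e'). (\<alpha> b c :: 'p, b, c, e)) K" for \<alpha>
  define T' where "T' \<alpha> = map (\<lambda>(b, c, e, e'). (\<alpha> b c :: 'p, b, c, e')) K" for \<alpha>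
  let ?Y = "map (\<lambda>(b, c, e, e'). (b, c, e)) K" and ?Y' = "map (\<lambda>(b, c, e, e'). (b, c, e')) K"
  have psi'_T: "psi' (tableau (T \<alpha>)) = tableau ?Y" "psi' (tableau (T' \<alpha>)) = tableau ?Y'"
    and psi_T: "psi (tableau (T' \<alpha>)) = psi (tableau (T \<alpha>))" for \<alpha>
    by (simp_all add: T_def T'_def psi_def psi'_def marginal_tableau comp_def case_prod_unfold)
  have cells: "map cell (T \<alpha>) = map (\<lambda>(b, c, e, e'). (b, c)) K"
    "map cell (T' \<alpha>) = map (\<lambda>(b, c, e, e'). (b, c)) K" for \<alpha>
    by (simp_all add: T_def T'_def cell_def comp_def case_prod_unfold)
  have moves: "tableau (T' \<alpha>) - tableau (T \<alpha>) \<in> signed_moves" for \<alpha>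
    unfolding T_def T'_def by (rule K(4))
  have u_pos: "0 < psi' u $ (b, c, e)" if "D b c e < 0" for b c e
    using that F_psi_nonneg(2)[OF vF, of "(b, c, e)"] by (simp add: D_def)
  have v_pos: "0 < psi' v $ (b, c, e)" if "0 < D b c e" for b c e
    using that F_psi_nonneg(2)[OF u, of "(b, c, e)"] by (simp add: D_def)
  obtain \<alpha> where \<alpha>: "\<And>b c e. 0 < psi' u $ (b, c, e) \<Longrightarrow> 0 < psi u $ (\<alpha> b c, b, c)"
    using psi'_pos_choice[OF u] by blast
  obtain \<eta> where \<eta>: "\<And>b c e. 0 < psi' v $ (b, c, e) \<Longrightarrow> 0 < psi v $ (\<eta> b c, b, c)"
    using psi'_pos_choice[OF vF] by blast
  let ?m = "tableau (T' \<alpha>) - tableau (T \<alpha>)" and ?n = "tableau (T \<eta>) - tableau (T' \<eta>)"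
  have "0 < psi u $ (a, b, c) \<and> 0 < psi' u $ (b, c, e)" if "(a, b, c, e) \<in> set (T \<alpha>)"
    for a b c e
  proof -
    from that obtain e' where "(b, c, e, e') \<in> set K" "a = \<alpha> b c"
      by (auto simp: T_def)
    then show ?thesis
      using K(3) u_pos \<alpha> by blast
  qed
  note apply_move[OF u _ this moves, unfolded cells, OF K(2)]
  then obtain w where w: "linked u w" "psi w = psi u" "psi' w = psi' u" "w + ?m \<in> F"
    by blast
  have "0 < psi v $ (a, b, c) \<and> 0 < psi' v $ (b, c, e)" if "(a, b, c, e) \<in> set (T' \<eta>)"
    for a b c e
  proof -
    from that obtain e' where "(b, c, e', e) \<in> set K" "a = \<eta> b c"
      by (auto simp: T'_def)
    then show ?thesis
      using K(3) v_pos \<eta> by blast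
  qed
  note apply_move[OF vF _ this signed_moves_swap[OF moves], unfolded cells, OF K(2)]
  then obtain x where x: "linked v x" "x + ?n \<in> F"
    by blast
  have "psi ?n = - psi ?m" "psi' ?n = - psi' ?m"
    using psi_T psi'_T by (simp_all add: psi_def psi'_def marginal_diff)
  then have "can_descend u \<or> linked u (w + ?m)"
    using descend_or_linked_opposite[OF v x w(1,4) moves] by blast
  moreover have "psi (w + ?m) = psi u"
    using w(2) psi_T by (simp add: psi_def marginal_add marginal_diff)
  moreover have "l1_norm (psi' v - psi' (w + ?m)) < l1_norm (psi' v - psi' u)"
  proof -
    have "psi' v - psi' (w + ?m) = psi' v - psi' u - (tableau ?Y' - tableau ?Y)"
      using w(3) psi'_T by (simp add: psi'_def marginal_add marginal_diff)
    also have "l1_norm \<dots> = l1_norm (psi' v - psi' u) - int (length ?Y) - int (length ?Y')"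
    proof (rule l1_norm_decrease)
      have "map (\<lambda>(b, c, e). (b, c)) ?Y = map (\<lambda>(b, c, e, e'). (b, c)) K"
        "map (\<lambda>(b, c, e). (b, c)) ?Y' = map (\<lambda>(b, c, e, e'). (b, c)) K"
        by (simp_all add: comp_def case_prod_unfold)
      then have "distinct (map (\<lambda>(b, c, e). (b, c)) ?Y)" "distinct (map (\<lambda>(b, c, e). (b, c)) ?Y')"
        by (simp_all only: K(2))
      then show "distinct ?Y" "distinct ?Y'"
        by (simp_all only: distinct_map[of _ ?Y] distinct_map[of _ ?Y'])
    qed (use K(3) in \<open>auto simp: D_def\<close>)
    also have "\<dots> < l1_norm (psi' v - psi' u)"
      using K(1) by simp
    finally show ?thesis .
  qed
  ultimately show ?thesis
    by blast
qed

lemma descend_or_linked_of_xi_eq: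
  assumes "u \<in> F" "is_minimum R F v" "xi u = xi v"
  shows "can_descend u \<or> linked u v"
  using assms
proof (induction "nat (l1_norm (psi v - psi u) + l1_norm (psi' v - psi' u))"
    arbitrary: u rule: less_induct)
  case less
  have vF: "v \<in> F"
    using less.prems by (simp add: is_minimum_def)
  have closer: ?case
    if "linked u w" "xi w = xi u"
      "l1_norm (psi v - psi w) + l1_norm (psi' v - psi' w)
        < l1_norm (psi v - psi u) + l1_norm (psi' v - psi' u)" for w
  proof -
    have "can_descend w \<or> linked w v"
      using that less.prems linked_in_F[OF that(1)]
        l1_norm_nonneg[of "psi v - psi w"] l1_norm_nonneg[of "psi' v - psi' w"]
      by (intro less.hyps) auto
    then show ?thesis
      using that(1) can_descend_linked linked_trans by blast
  qed
  consider "psi u \<noteq> psi v" | "psi' u \<noteq> psi' v" | "psi u = psi v" "psi' u = psi' v"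
    by blast
  then show ?case
  proof cases
    case 1
    from psi_step[OF less.prems 1] show ?thesis
      using closer by (auto simp: xi_eq)
  next
    case 2
    from psi'_step[OF less.prems 2] show ?thesis
      using closer by (auto simp: xi_def)
  next
    case 3
    then show ?thesis
      using linked_of_psi_eq less.prems(1) vF by blast
  qed
qed


text \<open>
  The four combinations of direct and indirect transports on the two sides. In the first three cases
  \<open>m1\<close> is a single move and \<open>m2\<close> is zero, which is itself a degenerate swap. In the last case \<open>m1\<close> and
  \<open>m2\<close> transport one unit from \<open>k\<close> to \<open>h\<close> and from \<open>h\<close> to \<open>l\<close>, respectively.
\<close>

lemma xi_step:
  assumes u: "u \<in> F" and v: "v \<in> F"
    and dec: "xi v $ (1, k) < xi u $ (1, k)" and inc: "xi u $ (1, l) < xi v $ (1, l)"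
  obtains w m1 m2 where "linked u w" "m1 \<in> signed_moves" "m2 \<in> signed_moves"
    "w + m1 \<in> F" "w + m2 \<in> F" "w + (m1 + m2) \<in> F" "xi w = xi u"
    "xi (m1 + m2) = tableau [(1, l), (2, k)] - tableau [(1, k), (2, l)]"
proof -
  note result = that
  have kl: "k \<noteq> l"
    using dec inc by auto
  have "card {k, l} \<noteq> CARD(3)"
    using kl by simp
  then have "{k, l} \<noteq> UNIV"
    by metis
  then obtain h where h: "h \<noteq> k" "h \<noteq> l"
    by blast
  have UNIV_khl: "UNIV = {k, h, l}"
    by (rule card_subset_eq[symmetric]) (use h kl in auto)
  have left: "(\<exists>a. 0 < psi u $ (a, 1, k) \<and> 0 < psi u $ (a, 2, l)) \<or>
    (\<exists>a a'. 0 < psi u $ (a, 1, k) \<and> 0 < psi u $ (a, 2, h) \<and>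
      0 < psi u $ (a', 1, h) \<and> 0 < psi u $ (a', 2, l))"
    by (rule exchange[of "\<lambda>a b c. psi v $ (a, b, c)" "\<lambda>a b c. psi u $ (a, b, c)",
        OF F_psi_nonneg(1)[OF v] F_psi_sums(1,2)[OF u v] dec[unfolded xi_nth] inc[unfolded xi_nth]
          UNIV_khl h(1)[symmetric] h(2) kl])
  have right: "(\<exists>e. 0 < psi' u $ (1, k, e) \<and> 0 < psi' u $ (2, l, e)) \<or>
    (\<exists>e e'. 0 < psi' u $ (1, k, e) \<and> 0 < psi' u $ (2, h, e) \<and>
      0 < psi' u $ (1, h, e') \<and> 0 < psi' u $ (2, l, e'))"
    by (rule exchange[of "\<lambda>e b c. psi' v $ (b, c, e)" "\<lambda>e b c. psi' u $ (b, c, e)",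
        OF F_psi_nonneg(2)[OF v] F_psi_sums(3,4)[OF u v] dec[unfolded xi_nth'] inc[unfolded xi_nth']
          UNIV_khl h(1)[symmetric] h(2) kl])
  obtain \<epsilon> where \<epsilon>: "\<And>a b c. 0 < psi u $ (a, b, c) \<Longrightarrow> 0 < psi' u $ (b, c, \<epsilon> b c)"
    using psi_pos_choice[OF u] by blast
  obtain \<alpha> where \<alpha>: "\<And>b c e. 0 < psi' u $ (b, c, e) \<Longrightarrow> 0 < psi u $ (\<alpha> b c, b, c)"
    using psi'_pos_choice[OF u] by blast
  have single: thesis
    if T: "distinct (map cell T)" "tableau T' - tableau T \<in> signed_moves"
      "\<And>a b c e. (a, b, c, e) \<in> set T \<Longrightarrow> 0 < psi u $ (a, b, c) \<and> 0 < psi' u $ (b, c, e)"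
      and xi_T: "xi (tableau T' - tableau T) = tableau [(1, l), (2, k)] - tableau [(1, k), (2, l)]"
    for T T'
  proof -
    obtain w where w: "linked u w" "psi w = psi u" "w + (tableau T' - tableau T) \<in> F"
      using apply_move[OF u T(1,3,2)] by blast
    show thesis
      by (rule result[of w "tableau T' - tableau T" 0])
        (use w T(2) xi_T zero_signed_move linked_in_F[OF w(1)] in \<open>simp_all add: xi_def\<close>)
  qed
  consider
    (one_one) a e where
      "0 < psi u $ (a, 1, k)" "0 < psi u $ (a, 2, l)"
      "0 < psi' u $ (1, k, e)" "0 < psi' u $ (2, l, e)"
  | (two_one) a1 a2 e where
      "0 < psi u $ (a1, 1, k)" "0 < psi u $ (a1, 2, h)"
      "0 < psi u $ (a2, 1, h)" "0 < psi u $ (a2, 2, l)"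
      "0 < psi' u $ (1, k, e)" "0 < psi' u $ (2, l, e)"
  | (one_two) a e1 e2 where
      "0 < psi u $ (a, 1, k)" "0 < psi u $ (a, 2, l)"
      "0 < psi' u $ (1, k, e1)" "0 < psi' u $ (2, h, e1)"
      "0 < psi' u $ (1, h, e2)" "0 < psi' u $ (2, l, e2)"
  | (two_two) a1 a2 e1 e2 where
      "0 < psi u $ (a1, 1, k)" "0 < psi u $ (a1, 2, h)"
      "0 < psi u $ (a2, 1, h)" "0 < psi u $ (a2, 2, l)"
      "0 < psi' u $ (1, k, e1)" "0 < psi' u $ (2, h, e1)"
      "0 < psi' u $ (1, h, e2)" "0 < psi' u $ (2, l, e2)"
    using left right by (elim disjE exE conjE) (rule that; assumption)+
  then show thesis
  proof cases
    case one_one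
    show thesis
    proof (rule single[of "[(a, 1, k, e), (a, 2, l, e)]" "[(a, 1, l, e), (a, 2, k, e)]"])
      show "tableau [(a, 1, l, e), (a, 2, k, e)] - tableau [(a, 1, k, e), (a, 2, l, e)]
          \<in> signed_moves"
        by (simp only: signed_moves_def C4_moves_intros UnI1)
    qed (use one_one in \<open>auto simp: cell_def xi_marginal marginal_simps\<close>)
  next
    case two_one
    let ?T = "[(a1, 1, k, e), (a1, 2, h, \<epsilon> 2 h), (a2, 1, h, \<epsilon> 1 h), (a2, 2, l, e)]"
    let ?T' = "[(a1, 1, h, \<epsilon> 1 h), (a1, 2, k, e), (a2, 1, l, e), (a2, 2, h, \<epsilon> 2 h)]"
    show thesis
    proof (rule single[of ?T ?T'])
      show "tableau ?T' - tableau ?T \<in> signed_moves"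
        by (rule signed_moves_swap) (simp only: signed_moves_def C4_moves_intros UnI1)
      show "distinct (map cell ?T)"
        using h kl by (simp add: cell_def)
      show "xi (tableau ?T' - tableau ?T) = tableau [(1, l), (2, k)] - tableau [(1, k), (2, l)]"
        by (simp add: xi_marginal marginal_simps, simp add: tableau_Cons)
    qed (use two_one \<epsilon> in auto)
  next
    case one_two
    let ?T = "[(a, 1, k, e1), (\<alpha> 2 h, 2, h, e1), (\<alpha> 1 h, 1, h, e2), (a, 2, l, e2)]"
    let ?T' = "[(\<alpha> 1 h, 1, h, e1), (a, 2, k, e1), (a, 1, l, e2), (\<alpha> 2 h, 2, h, e2)]"
    show thesis
    proof (rule single[of ?T ?T'])
      show "tableau ?T' - tableau ?T \<in> signed_moves"
        by (rule signed_moves_swap) (simp only: signed_moves_def C4_moves_intros UnI1)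
      show "distinct (map cell ?T)"
        using h kl by (simp add: cell_def)
      show "xi (tableau ?T' - tableau ?T) = tableau [(1, l), (2, k)] - tableau [(1, k), (2, l)]"
        by (simp add: xi_marginal marginal_simps, simp add: tableau_Cons)
    qed (use one_two \<alpha> in auto)
  next
    case two_two
    let ?T1 = "[(a1, 1, k, e1), (a1, 2, h, e1)]" and ?T1' = "[(a1, 1, h, e1), (a1, 2, k, e1)]"
    let ?T2 = "[(a2, 1, h, e2), (a2, 2, l, e2)]" and ?T2' = "[(a2, 1, l, e2), (a2, 2, h, e2)]"
    let ?m1 = "tableau ?T1' - tableau ?T1" and ?m2 = "tableau ?T2' - tableau ?T2"
    have m1: "?m1 \<in> signed_moves" and m2: "?m2 \<in> signed_moves"
      by (simp_all only: signed_moves_def C4_moves_intros UnI1)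
    have dist: "distinct (map cell (?T1 @ ?T2))"
      using h kl by (simp add: cell_def)
    have "\<exists>w. linked u w \<and> psi w = psi u \<and> psi' w = psi' u \<and> (\<forall>t\<in>set (?T1 @ ?T2). 0 < w $ t)"
      by (rule bring_rows_together[OF u dist]) (use two_two in auto)
    then obtain w where w: "linked u w" "psi w = psi u" "\<forall>t\<in>set (?T1 @ ?T2). 0 < w $ t"
      by blast
    have wF: "w \<in> F"
      using linked_in_F[OF w(1)] ..
    have in_F: "w + ?m1 \<in> F" "w + ?m2 \<in> F"
      by (rule F_add[OF wF m1 add_move_nonneg] F_add[OF wF m2 add_move_nonneg],
          use w(3) F_nonneg[OF wF] h kl in auto)+
    have "0 \<le> (w + (tableau (?T1' @ ?T2') - tableau (?T1 @ ?T2))) $ i" for i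
      using w(3) wF dist by (intro add_move_nonneg F_nonneg) (auto simp: distinct_map)
    moreover have "w + (tableau (?T1' @ ?T2') - tableau (?T1 @ ?T2)) = w + ?m1 + ?m2"
      by (simp only: tableau_append add_diff_add add.assoc)
    ultimately have "0 \<le> (w + ?m1 + ?m2) $ i" for i
      by (simp only:)
    then have "w + (?m1 + ?m2) \<in> F"
      using F_add[OF in_F(1) m2] by (simp only: add.assoc)
    moreover have "xi (?m1 + ?m2) = tableau [(1, l), (2, k)] - tableau [(1, k), (2, l)]"
      by (simp add: xi_marginal marginal_simps, simp add: tableau_Cons)
    moreover have "xi w = xi u"
      using w(2) by (simp add: xi_def)
    ultimately show thesis
      using result[OF w(1) m1 m2 in_F] by blast
  qed
qed

lemma xi_F_sums:
  assumes "u \<in> F" "v \<in> F"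
  shows "(\<Sum>c\<in>UNIV. xi u $ (1, c)) = (\<Sum>c\<in>UNIV. xi v $ (1, c))"
    and "xi u $ (1, c) + xi u $ (2, c) = xi v $ (1, c) + xi v $ (2, c)"
proof -
  have "(\<Sum>c\<in>UNIV. xi w $ (1, c)) = (\<Sum>a\<in>UNIV. \<Sum>c\<in>UNIV. psi w $ (a, 1, c))"
    for w :: "int ^ ('p \<times> 2 \<times> 3 \<times> 'q)"
    unfolding xi_nth by (rule sum.swap)
  then show "(\<Sum>c\<in>UNIV. xi u $ (1, c)) = (\<Sum>c\<in>UNIV. xi v $ (1, c))"
    by (simp add: F_psi_sums(1)[OF assms])
  show "xi u $ (1, c) + xi u $ (2, c) = xi v $ (1, c) + xi v $ (2, c)"
    unfolding xi_nth sum.distrib[symmetric] by (simp add: F_psi_sums(2)[OF assms])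
qed

lemma xi_add: "xi (u + v) = xi u + xi v"
  by (simp add: xi_marginal marginal_add)

text \<open>
  The steps at \<open>u\<close> and at the minimum \<open>v\<close> may be of different kinds, but they change \<open>\<xi>\<close> by opposite
  amounts. The comparison is therefore carried over from \<open>v\<close> to \<open>u\<close> through the preorder on
  \<open>\<xi>\<close>.
\<close>

lemma linked_xi_step:
  assumes u: "u \<in> F" and v: "is_minimum R F v" and xi: "xi u \<noteq> xi v"
  shows "can_descend u \<or> (\<exists>w. linked u w \<and> l1_norm (xi v - xi w) < l1_norm (xi v - xi u))"
proof -
  have vF: "v \<in> F"
    using v by (simp add: is_minimum_def)
  define D where "D c = xi v $ (1, c) - xi u $ (1, c)" for c
  have D2: "xi v $ (2, c) - xi u $ (2, c) = - D c" for c
    using xi_F_sums(2)[OF u vF, of c] by (simp add: D_def)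
  have sum_D: "(\<Sum>c\<in>UNIV. D c) = 0"
    using xi_F_sums(1)[OF u vF] by (simp add: D_def sum_subtractf)
  obtain b c where "xi u $ (b, c) \<noteq> xi v $ (b, c)"
    using xi by (metis prod.exhaust vec_eq_iff)
  then have "D c \<noteq> 0"
    using exhaust_2[of b] D2[of c] by (auto simp: D_def)
  then obtain k l where kl: "D k < 0" "0 < D l"
    using zero_sum_sign_change[OF sum_D] by (metis linorder_neqE)
  let ?\<delta> = "tableau [(1, l), (2, k)] - tableau [(1, k), (2, l)] :: int ^ (2 \<times> 3)"
  have dec: "xi v $ (1, k) < xi u $ (1, k)" and inc: "xi u $ (1, l) < xi v $ (1, l)"
    using kl by (simp_all add: D_def)
  obtain w m1 m2 where w: "linked u w" "m1 \<in> signed_moves" "m2 \<in> signed_moves"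
    "w + m1 \<in> F" "w + m2 \<in> F" "w + (m1 + m2) \<in> F" "xi w = xi u" "xi (m1 + m2) = ?\<delta>"
    by (rule xi_step[OF u vF dec inc])
  obtain x n1 n2 where x: "linked v x" "x + (n1 + n2) \<in> F" "xi x = xi v"
    "xi (n1 + n2) = tableau [(1, k), (2, l)] - tableau [(1, l), (2, k)]"
    by (rule xi_step[OF vF u inc dec])
  have xi_n: "xi (n1 + n2) = - ?\<delta>"
    using x(4) by simp
  have wF: "w \<in> F" and xF: "x \<in> F"
    using w(1) x(1) linked_in_F by auto
  have "?\<delta> $ (1, l) \<noteq> 0"
    using kl by (auto simp: tableau_nth_distinct)
  then have \<delta>: "?\<delta> \<noteq> 0"
    by (metis zero_index)
  have "R (x + (n1 + n2)) x"
    using minimum_step[OF v x(1,2)] by (simp only: R_add_left)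
  then have "A (xi x + - ?\<delta>) (xi x)"
    using compatible_xi F_fiber x(2) xi_n xF \<delta> unfolding compatible_def
    by (metis add_cancel_right_right neg_equal_0_iff_equal xi_add)
  then have "A (xi x + - ?\<delta> + (?\<delta> - xi x + xi w)) (xi x + (?\<delta> - xi x + xi w))"
    using preorder_A unfolding additive_preorder_def by blast
  then have "A (xi w) (xi w + ?\<delta>)"
    by (simp add: algebra_simps)
  then have "R w (w + (m1 + m2))"
    using compatible_xi F_fiber w(6,8) wF \<delta> unfolding compatible_def
    by (metis add_cancel_right_right xi_add)
  then have "R 0 (m1 + m2)"
    by (simp only: R_add_right)
  then have "can_descend u \<or> linked u (w + (m1 + m2))"
    using descend_or_linked w by blast
  moreover have "l1_norm (xi v - xi (w + (m1 + m2))) < l1_norm (xi v - xi u)"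
  proof -
    have "xi v - xi (w + (m1 + m2)) = xi v - xi u - ?\<delta>"
      unfolding xi_add[of w] w(7,8) by simp
    moreover have "l1_norm (xi v - xi u - ?\<delta>) < l1_norm (xi v - xi u)"
      using kl D2[of k] D2[of l] by (subst l1_norm_decrease) (auto simp: D_def)
    ultimately show ?thesis
      by (simp only:)
  qed
  ultimately show ?thesis
    by blast
qed

lemma descend_or_linked_minimum:
  assumes "u \<in> F" "is_minimum R F v"
  shows "can_descend u \<or> linked u v"
  using assms
proof (induction "nat (l1_norm (xi v - xi u))" arbitrary: u rule: less_induct)
  case less
  show ?case
  proof (cases "xi u = xi v")
    case True
    then show ?thesis
      using descend_or_linked_of_xi_eq less.prems by blast
  next
    case False
    then consider "can_descend u"
      | w where "linked u w" "l1_norm (xi v - xi w) < l1_norm (xi v - xi u)"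
      using linked_xi_step less.prems by blast
    then show ?thesis
    proof cases
      case (2 w)
      then have "can_descend w \<or> linked w v"
        using less.prems linked_in_F[OF 2(1)] l1_norm_nonneg[of "xi v - xi w"]
        by (intro less.hyps) auto
      then show ?thesis
        using 2(1) can_descend_linked linked_trans by blast
    qed simp
  qed
qed

section \<open>The Groebner property\<close>

lemma finite_F: "finite F"
proof (cases "F = {}")
  case False
  then obtain u where u: "u \<in> F"
    by blast
  define g :: "'p \<times> 2 \<times> 3 \<times> 'q \<Rightarrow> int"
    where "g = (\<lambda>(a, b, c, e). \<Sum>c\<in>UNIV. psi u $ (a, b, c))"
  have "v $ t \<le> g t" if "v \<in> F" for v t
  proof -
    obtain a b c e where t: "t = (a, b, c, e)"
      by (cases t)
    have "v $ (a, b, c, e) \<le> psi v $ (a, b, c)"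
      unfolding psi_nth using F_nonneg[OF that] by (intro member_le_sum) auto
    also have "\<dots> \<le> (\<Sum>c\<in>UNIV. psi v $ (a, b, c))"
      using F_psi_nonneg[OF that] by (intro member_le_sum) auto
    also have "\<dots> = g t"
      using F_psi_sums(1)[OF that u] by (simp add: g_def t)
    finally show ?thesis
      by (simp add: t)
  qed
  then have "vec_nth v \<in> Pi\<^sub>E UNIV (\<lambda>t. {0..g t})" if "v \<in> F" for v
    using F_nonneg that by auto
  then have "F \<subseteq> vec_lambda ` Pi\<^sub>E UNIV (\<lambda>t. {0..g t})"
    by (auto intro!: image_eqI[where f = vec_lambda, OF vec_nth_inverse[symmetric]])
  then show ?thesis
    by (rule finite_subset) (intro finite_imageI finite_PiE finite_atLeastAtMost_int finite)
qed simp

lemma exists_minimum: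
  assumes "S \<noteq> {}" "S \<subseteq> F"
  shows "\<exists>w\<in>S. \<forall>z\<in>S. R z w"
proof -
  have "finite S"
    using assms(2) finite_F by (rule finite_subset)
  then show ?thesis
    using assms(1)
  proof (induction rule: finite_ne_induct)
    case (singleton x)
    then show ?case
      by (simp add: R_refl)
  next
    case (insert x S)
    then obtain w where w: "w \<in> S" "\<forall>z\<in>S. R z w"
      by blast
    show ?case
    proof (cases "R x w")
      case True
      with w show ?thesis by blast
    next
      case False
      then have "R w x"
        using R_total by blast
      then have "\<forall>z\<in>insert x S. R z x"
        using w(2) R_refl by (auto intro: R_trans)
      then show ?thesis by blast
    qed
  qed
qed

text \<open>
  A smallest element among those that can be reached from \<open>u\<close> cannot descend any further, hence it
  is linked to \<open>v\<close>.
\<close>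

lemma minimum_reachable:
  assumes "u \<in> F" "is_minimum R F v"
  shows "(u, v) \<in> E\<^sup>*"
proof -
  have "{w. (u, w) \<in> E\<^sup>*} \<noteq> {}" "{w. (u, w) \<in> E\<^sup>*} \<subseteq> F"
    using path_in_F assms(1) by auto
  from exists_minimum[OF this] obtain w where
    w: "(u, w) \<in> E\<^sup>*" "\<And>z. (u, z) \<in> E\<^sup>* \<Longrightarrow> R z w"
    by blast
  have "\<not> can_descend w"
    using w(2) rtrancl_trans[OF w(1)] unfolding can_descend_def by blast
  then have "linked w v"
    using descend_or_linked_minimum[OF path_in_F[OF w(1) assms(1)] assms(2)] by simp
  then have "(w, v) \<in> E\<^sup>*"
    by (simp add: mutually_reachable_def)
  with w(1) show ?thesis
    by (rule rtrancl_trans)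
qed

text \<open>
  A class without outgoing edges is closed under paths, so it contains the minimum \<open>v\<close> and is the
  class of \<open>v\<close>.
\<close>

lemma groebner_fiber:
  "weakly_connected F E \<and>
   (\<forall>C \<in> quotient_sinks F E. \<forall>D \<in> quotient_sinks F E. C = D) \<and>
   (\<forall>C \<in> quotient_sinks F E. \<forall>u\<in>C. is_minimum R F u)"
proof (cases "F = {}")
  case True
  have "quotient_sinks F E = {}" "weakly_connected F E"
    unfolding quotient_sinks_def weakly_connected_def True by simp_all
  then show ?thesis
    by simp
next
  case False
  then obtain v where v: "is_minimum R F v"
    using exists_minimum[OF False subset_refl] unfolding is_minimum_def by blast
  have "(u, u') \<in> (E \<union> E\<inverse>)\<^sup>*" if "u \<in> F" "u' \<in> F" for u u'
  proof -
    have "(u, v) \<in> (E \<union> E\<inverse>)\<^sup>*"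
      by (rule subsetD[OF rtrancl_mono[OF Un_upper1] minimum_reachable[OF that(1) v]])
    moreover have "(v, u') \<in> (E\<inverse>)\<^sup>*"
      using minimum_reachable[OF that(2) v] by (simp add: rtrancl_converse)
    then have "(v, u') \<in> (E \<union> E\<inverse>)\<^sup>*"
      by (rule subsetD[OF rtrancl_mono[OF Un_upper2]])
    ultimately show ?thesis
      by (rule rtrancl_trans)
  qed
  then have connected: "weakly_connected F E"
    by (simp add: weakly_connected_def)
  have equiv: "equiv F (mutually_reachable F E)"
    by (rule equivI) (auto simp: mutually_reachable_def refl_on_def sym_def trans_def)
  have sink: "C = mutually_reachable F E `` {v}" if C: "C \<in> quotient_sinks F E" for C
  proof -
    have C_class: "C \<in> F // mutually_reachable F E"
      and no_exit: "\<And>D. (C, D) \<notin> quotient_edges F E"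
      using C by (auto simp: quotient_sinks_def)
    obtain u where u: "u \<in> F" "C = mutually_reachable F E `` {u}"
      using C_class by (auto elim: quotientE)
    have "z \<in> C" if "(u, z) \<in> E\<^sup>*" for z
      using that
    proof (induction rule: rtrancl_induct)
      case base
      then show ?case
        using u linked_refl by blast
    next
      case (step z z')
      have z': "z' \<in> F"
        using step.hyps(2) by (simp add: move_graph_def)
      show ?case
      proof (rule ccontr)
        assume "z' \<notin> C"
        moreover have "z' \<in> mutually_reachable F E `` {z'}"
          using linked_refl[OF z'] by simp
        ultimately have "(C, mutually_reachable F E `` {z'}) \<in> quotient_edges F E"
          using C_class step z' by (auto simp: quotient_edges_def intro: quotientI)
        with no_exit show False by blast
      qed
    qed
    then have "v \<in> C"
      using minimum_reachable[OF u(1) v] by blast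
    then show ?thesis
      using u equiv_class_eq[OF equiv, of u v] by simp
  qed
  have "is_minimum R F u" if "C \<in> quotient_sinks F E" "u \<in> C" for C u
  proof -
    have "linked v u"
      using sink[OF that(1)] that(2) by simp
    then show ?thesis
      using v linked_R[of v u] linked_in_F[of v u] by (auto simp: is_minimum_def intro: R_trans)
  qed
  then show ?thesis
    using connected sink by blast
qed

end

theorem theorem47:
  fixes ge_X :: "int ^ ('p::finite \<times> 2 \<times> 3 \<times> 'q::finite) \<Rightarrow> int ^ ('p \<times> 2 \<times> 3 \<times> 'q) \<Rightarrow> bool"
    and ge_B :: "int ^ ('p \<times> 2 \<times> 3) \<Rightarrow> int ^ ('p \<times> 2 \<times> 3) \<Rightarrow> bool"
    and ge_B' :: "int ^ (2 \<times> 3 \<times> 'q) \<Rightarrow> int ^ (2 \<times> 3 \<times> 'q) \<Rightarrow> bool"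
    and ge_A :: "int ^ (2 \<times> 3) \<Rightarrow> int ^ (2 \<times> 3) \<Rightarrow> bool"
  assumes "CARD('p) \<ge> 2" and "CARD('q) \<ge> 2"
    and "additive_preorder ge_X" and "additive_preorder ge_B"
    and "additive_preorder ge_B'" and "additive_preorder ge_A"
    and "compatible B_left phi ge_B ge_A"
    and "compatible B_right phi' ge_B' ge_A"
    and "compatible B_C4 xi ge_X ge_A"
    and "\<And>u1 u2. ge_B (psi u1) (psi u2) \<Longrightarrow> ge_B' (psi' u1) (psi' u2) \<Longrightarrow> ge_X u1 u2"
  shows "groebner_basis ge_X C4_moves (fibers B_C4)"
proof -
  have "ge_X u v" if "psi u = psi v" "psi' u = psi' v" for u v
    using assms(4,5) assms(10)[of u v] that by (simp add: additive_preorder_def reflp_def)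
  then have "C4_fiber ge_X ge_A F" if "F \<in> fibers B_C4" for F
    using assms(3,6,9) that by unfold_locales
  then show ?thesis
    unfolding groebner_basis_def by (intro ballI C4_fiber.groebner_fiber)
qed

end
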